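(* Let $d,m\in\mathbb{N}$, let $\mathcal{X}\subseteq\mathbb{R}^d$ be a bounded domain, $\mathcal{Y}=\{-1,1\}$, $\mathcal{Z}=\mathcal{X}\times\mathcal{Y}$, and let $\rho$ be a probability distribution on $\mathcal{Z}$. Let ${\bf z}=\{z_i=(x_i,y_i): i=1,\dots,m\}$ be drawn i.i.d. from $\rho$. Fix $r>0$, $\lambda>0$ and a matrix norm $\|\cdot\|$ on $d\times d$ matrices. For symmetric $A\in\mathbb{S}^{d\times d}$ let $K_A(x,x')=x^TAx'$ and $$\mathcal{E}_{\bf z}(A)=\frac1m\sum_{i=1}^m\Big(1-\frac{1}{mr}\sum_{j=1}^m y_iy_jK_A(x_i,x_j)\Big)_+,$$ and let $A_{\bf z}\in\arg\min_{A\in\mathbb{S}^{d\times d}}\big[\mathcal{E}_{\bf z}(A)+\lambda\|A\|\big]$. For $f:\mathcal{X}\to\mathbb{R}$ let $\mathscr{E}_{\bf z}(f)=\frac1m\sum_{i=1}^m(1-y_if(x_i))_+$ and $\mathscr{E}(f)=\int_{\mathcal{Z}}(1-yf(x))_+\,d\rho(x,y)$, and let $$f_{\bf z}\in\arg\min\Big\{\mathscr{E}_{\bf z}(f) : f=\sum_{j=1}^m\alpha_jK_{A_{\bf z}}(x_j,\cdot),\ \alpha_j\in\mathbb{R},\ \sum_{j=1}^m|\alpha_j|\le 1/r\Big\}.$$ Then for any $0<\delta<1$, with probability at least $1-\delta$ over ${\bf z}$, $$\mathscr{E}(f_{\bf z})-\mathscr{E}_{\bf z}(f_{\bf z})\le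 \frac{4\mathcal{R}_m}{\lambda r}+\frac{2X_*}{\lambda r}\sqrt{\frac{2\log(1/\delta)}{m}},$$ where $X_*=\sup_{x,x'\in\mathcal{X}}\|x'x^T\|_*$ and $\mathcal{R}_m=\mathbb{E}_{{\bf z},\sigma}\Big[\sup_{\tilde x\in\mathcal{X}}\Big\|\frac1m\sum_{i=1}^m\sigma_iy_ix_i\tilde x^T\Big\|_*\Big]$.
   Context: $(t)_+=\max(t,0)$. The dual norm is $\|B\|_*=\sup_{\|A\|\le1}\mathrm{trace}(B^TA)$. In $\mathcal{R}_m$, $\sigma_1,\dots,\sigma_m$ are i.i.d. Rademacher variables ($P(\sigma_i=\pm1)=1/2$) independent of ${\bf z}$, and the expectation is over both ${\bf z}$ and $\sigma$. $\mathbb{S}^{d\times d}$ denotes the symmetric $d\times d$ real matrices. *)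

theory Defs
  imports "HOL-Probability.Probability"
begin

definition pos_part :: "real \<Rightarrow> real" where
  "pos_part t = max t 0"

text \<open>A norm on d x d real matrices (no submultiplicativity required).\<close>
definition is_matrix_norm :: "(real^'d^'d \<Rightarrow> real) \<Rightarrow> bool" where
  "is_matrix_norm N \<longleftrightarrow>
     (\<forall>A. 0 \<le> N A) \<and> (\<forall>A. N A = 0 \<longleftrightarrow> A = 0) \<and>
     (\<forall>c A. N (c *\<^sub>R A) = \<bar>c\<bar> * N A) \<and> (\<forall>A B. N (A + B) \<le> N A + N B)"

definition dual_norm :: "(real^'d^'d \<Rightarrow> real) \<Rightarrow> real^'d^'d \<Rightarrow> real" where
  "dual_norm N B = (SUP A\<in>{A. N A \<le> 1}. trace (transpose B ** A))"

definition outer :: "real^'d \<Rightarrow> real^'d \<Rightarrow> real^'d^'d" where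
  "outer a b = (\<chi> i j. a $ i * b $ j)"

definition kerA :: "real^'d^'d \<Rightarrow> real^'d \<Rightarrow> real^'d \<Rightarrow> real" where
  "kerA A x x' = x \<bullet> (A *v x')"

definition emp_risk_A :: "nat \<Rightarrow> real \<Rightarrow> (nat \<Rightarrow> (real^'d) \<times> real) \<Rightarrow> real^'d^'d \<Rightarrow> real" where
  "emp_risk_A m r z A = (1 / real m) * (\<Sum>i<m. pos_part (1 - (1 / (real m * r)) *
      (\<Sum>j<m. snd (z i) * snd (z j) * kerA A (fst (z i)) (fst (z j)))))"

definition hyp :: "nat \<Rightarrow> (nat \<Rightarrow> (real^'d) \<times> real) \<Rightarrow> real^'d^'d \<Rightarrow> (nat \<Rightarrow> real) \<Rightarrow> real^'d \<Rightarrow> real" where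
  "hyp m z A \<alpha> x = (\<Sum>j<m. \<alpha> j * kerA A (fst (z j)) x)"

definition emp_risk_f :: "nat \<Rightarrow> (nat \<Rightarrow> (real^'d) \<times> real) \<Rightarrow> (real^'d \<Rightarrow> real) \<Rightarrow> real" where
  "emp_risk_f m z f = (1 / real m) * (\<Sum>i<m. pos_part (1 - snd (z i) * f (fst (z i))))"

definition risk :: "((real^'d) \<times> real) measure \<Rightarrow> (real^'d \<Rightarrow> real) \<Rightarrow> real" where
  "risk rho f = (\<integral>p. pos_part (1 - snd p * f (fst p)) \<partial>rho)"

definition Xstar :: "(real^'d^'d \<Rightarrow> real) \<Rightarrow> (real^'d) set \<Rightarrow> real" where
  "Xstar N X = (SUP p\<in>X \<times> X. dual_norm N (outer (snd p) (fst p)))"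

definition rademacher :: "(real^'d^'d \<Rightarrow> real) \<Rightarrow> (real^'d) set \<Rightarrow> ((real^'d) \<times> real) measure \<Rightarrow> nat \<Rightarrow> real" where
  "rademacher N X rho m =
     (\<integral>z. (\<Sum>\<sigma>\<in>{..<m} \<rightarrow>\<^sub>E {-1, 1::real}.
             (SUP xt\<in>X. dual_norm N ((1 / real m) *\<^sub>R
                 (\<Sum>i<m. (\<sigma> i * snd (z i)) *\<^sub>R outer (fst (z i)) xt)))) / 2 ^ m
        \<partial>(PiM {..<m} (\<lambda>_. rho)))"

end

theory Submission
  imports Defs "HOL-Probability.Hoeffding"
begin

text \<open>
  Comparing the minimizer with \<open>A = 0\<close> gives \<open>N (Az z) \<le> 1 / lam\<close>, and every hypothesis is a
  linear functional \<open>x \<mapsto> v \<bullet> x\<close>. By duality \<open>v\<close> lies in the polar set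
  \<open>V = {v. \<forall>w. v \<bullet> w \<le> H w / (lam * r)}\<close> of \<open>H w = sup {dual_norm N (outer w x) | x \<in> X}\<close>, which does
  not depend on the sample, and \<open>H\<close> evaluated at the signed sample mean is the integrand of the
  Rademacher average. The uniform deviation over a countable dense subset of \<open>V\<close> is measurable;
  it concentrates by McDiarmid's inequality, and its mean is bounded by symmetrization and
  contraction. The argument gives half of the stated bound.
\<close>

section \<open>McDiarmid's inequality\<close>

text \<open>The selections \<open>Az\<close> and \<open>alpha\<close> come with no measurability,
  and the hypotheses they produce are built from the sample itself. The event is therefore
  constructed from \<open>V\<close> alone, and only afterwards is each selected hypothesis located
  in \<open>V\<close>, sample by sample. Symmetrization treats one coordinate at a time, with a
  bounded offset \<open>b k\<close> standing for all the others; the signs are a finite average, not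
  a further probability space. The suprema are one-sided, without absolute values, so contraction by
  the 1-Lipschitz hinge costs no factor beyond the 2 of symmetrization, and the first term is
  \<open>2 * rademacher N X rho m / (lam * r)\<close>. For the second term, changing one coordinate
  moves the averaged loss by at most \<open>2 * B / m\<close> with
  \<open>B = Xstar N X / (lam * r)\<close>, and McDiarmid's exponent equals
  \<open>ln \<delta>\<close> at deviation
  \<open>B * sqrt (2 * ln (1 / \<delta>) / m)\<close>.\<close>

lemma fun_upd_in_space_PiM_lessThan:
  assumes "z \<in> space (PiM {..<m} (\<lambda>_. M))" "p \<in> space M"
  shows "z(m := p) \<in> space (PiM {..<Suc m} (\<lambda>_. M))"
  using PiE_fun_upd[of p "\<lambda>_. space M" m z "{..<m}"] assms by (simp add: space_PiM lessThan_Suc)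

lemma measurable_fun_upd_lessThan:
  "(\<lambda>(z, p). z(m := p)) \<in> measurable (PiM {..<m} (\<lambda>_. M) \<Otimes>\<^sub>M M) (PiM {..<Suc m} (\<lambda>_. M))"
  using measurable_add_dim[of m "{..<m}" "\<lambda>_. M"] by (simp add: lessThan_Suc)

context prob_space
begin

lemma prob_space_PiM_iid: "prob_space (PiM I (\<lambda>_. M))"
  by (intro prob_space_PiM prob_space_axioms)

text \<open>The product over \<open>{..<Suc m}\<close> is the image of \<open>M\<close> times the
  product over \<open>{..<m}\<close> under updating coordinate \<open>m\<close>. Both orders of
  integration are recorded: symmetrization first integrates the last coordinate with the others
  frozen, then the others with the last one frozen.\<close>

lemma Fubini_PiM_lessThan_Suc:
  fixes f :: "(nat \<Rightarrow> 'a) \<Rightarrow> real"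
  assumes "integrable (PiM {..<Suc m} (\<lambda>_. M)) f"
  shows integral_PiM_lessThan_Suc:
      "(\<integral>z. f z \<partial>PiM {..<Suc m} (\<lambda>_. M)) = (\<integral>z. \<integral>p. f (z(m := p)) \<partial>M \<partial>PiM {..<m} (\<lambda>_. M))"
    and integral_PiM_lessThan_Suc_rev:
      "(\<integral>z. f z \<partial>PiM {..<Suc m} (\<lambda>_. M)) = (\<integral>p. \<integral>z. f (z(m := p)) \<partial>PiM {..<m} (\<lambda>_. M) \<partial>M)"
    and integrable_PiM_lessThan_Suc:
      "integrable (PiM {..<m} (\<lambda>_. M)) (\<lambda>z. \<integral>p. f (z(m := p)) \<partial>M)"
    and integrable_PiM_lessThan_Suc_rev:
      "integrable M (\<lambda>p. \<integral>z. f (z(m := p)) \<partial>PiM {..<m} (\<lambda>_. M))"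
proof -
  let ?P = "PiM {..<m} (\<lambda>_. M)" and ?Q = "PiM {..<Suc m} (\<lambda>_. M)"
  interpret P: prob_space ?P by (rule prob_space_PiM_iid)
  interpret MP: pair_prob_space M ?P ..
  have Q: "?Q = distr (M \<Otimes>\<^sub>M ?P) ?Q (\<lambda>(p, z). z(m := p))"
    using distr_pair_PiM_eq_PiM[of "{..<m}" "\<lambda>_. M" m] prob_space_axioms by (simp add: lessThan_Suc)
  have upd: "(\<lambda>(p, z). z(m := p)) \<in> measurable (M \<Otimes>\<^sub>M ?P) ?Q"
    using measurable_compose[OF measurable_pair_swap' measurable_fun_upd_lessThan]
    by (simp only: case_prod_unfold fst_conv snd_conv)
  have int: "integrable (M \<Otimes>\<^sub>M ?P) (\<lambda>(p, z). f (z(m := p)))"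
    using integrable_distr[OF upd, of f] assms unfolding Q[symmetric] by (simp only: case_prod_unfold)
  have "(\<integral>z. f z \<partial>?Q) = (\<integral>(p, z). f (z(m := p)) \<partial>(M \<Otimes>\<^sub>M ?P))"
    using integral_distr[OF upd, of f] assms unfolding Q[symmetric] by (simp add: case_prod_unfold)
  then show rev: "(\<integral>z. f z \<partial>?Q) = (\<integral>p. \<integral>z. f (z(m := p)) \<partial>?P \<partial>M)"
    by (subst (asm) MP.integral_fst'[OF int, symmetric]) (simp only: case_prod_conv)
  show "(\<integral>z. f z \<partial>?Q) = (\<integral>z. \<integral>p. f (z(m := p)) \<partial>M \<partial>?P)"
    unfolding rev by (rule MP.Fubini_integral[OF int, symmetric])
  show "integrable M (\<lambda>p. \<integral>z. f (z(m := p)) \<partial>?P)"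
    using MP.integrable_fst'[OF int] by (simp only: case_prod_conv)
  show "integrable ?P (\<lambda>z. \<integral>p. f (z(m := p)) \<partial>M)"
    by (rule MP.integrable_snd[OF int])
qed

text \<open>Induction on \<open>m\<close> in place of a martingale: integrating out the last
  coordinate gives \<open>f'\<close>, which again has differences at most \<open>c\<close>, and for
  frozen \<open>z\<close> Hoeffding's lemma bounds the exponential moment of the fluctuation around
  \<open>f' z\<close> by \<open>exp (s\<^sup>2 * c\<^sup>2 / 8)\<close>.\<close>

lemma mcdiarmid_mgf:
  fixes f :: "(nat \<Rightarrow> 'a) \<Rightarrow> real"
  assumes "f \<in> borel_measurable (PiM {..<m} (\<lambda>_. M))"
    and "\<And>z. z \<in> space (PiM {..<m} (\<lambda>_. M)) \<Longrightarrow> \<bar>f z\<bar> \<le> B"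
    and "\<And>i z p. i < m \<Longrightarrow> z \<in> space (PiM {..<m} (\<lambda>_. M)) \<Longrightarrow> p \<in> space M \<Longrightarrow>
            \<bar>f z - f (z(i := p))\<bar> \<le> c"
    and "s > 0"
  shows "(\<integral>z. exp (s * (f z - (\<integral>z. f z \<partial>PiM {..<m} (\<lambda>_. M)))) \<partial>PiM {..<m} (\<lambda>_. M))
           \<le> exp (s\<^sup>2 * c\<^sup>2 * real m / 8)"
  using assms(1-3)
proof (induction m arbitrary: f)
  case 0
  have "PiM {..<0::nat} (\<lambda>_. M) = count_space {\<lambda>_. undefined}"
    by (simp add: PiM_empty)
  then show ?case
    by (simp add: lebesgue_integral_count_space_finite)
next
  case (Suc m)
  let ?P = "PiM {..<m} (\<lambda>_. M)" and ?Q = "PiM {..<Suc m} (\<lambda>_. M)"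
  interpret P: prob_space ?P by (rule prob_space_PiM_iid)
  interpret Q: prob_space ?Q by (rule prob_space_PiM_iid)
  note [measurable] = Suc.prems(1)
  note bound = Suc.prems(2)
  note diff = Suc.prems(3)
  note upd = fun_upd_in_space_PiM_lessThan[of _ m M]
  have bound_upd: "\<bar>f (z(m := p))\<bar> \<le> B" if "z \<in> space ?P" "p \<in> space M" for z p
    using bound[OF upd[OF that]] .
  have comp: "(\<lambda>(z, p). f (z(m := p))) \<in> borel_measurable (?P \<Otimes>\<^sub>M M)"
    using measurable_compose[OF measurable_fun_upd_lessThan Suc.prems(1)] by (simp only: case_prod_unfold)
  have meas1: "(\<lambda>p. f (z(m := p))) \<in> borel_measurable M" if "z \<in> space ?P" for z
    using measurable_Pair2[OF comp that]
    by simp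
  have int1: "integrable M (\<lambda>p. f (z(m := p)))" if "z \<in> space ?P" for z
    by (rule integrable_const_bound[where B=B]) (use bound_upd meas1 that in auto)
  define f' where "f' z = (\<integral>p. f (z(m := p)) \<partial>M)" for z
  have f'_meas [measurable]: "f' \<in> borel_measurable ?P"
    unfolding f'_def by (rule borel_measurable_lebesgue_integral[OF comp])
  have f'_bound: "\<bar>f' z\<bar> \<le> B" if z: "z \<in> space ?P" for z
  proof -
    have "\<bar>f' z\<bar> \<le> (\<integral>p. \<bar>f (z(m := p))\<bar> \<partial>M)"
      unfolding f'_def by (rule integral_abs_bound)
    also have "\<dots> \<le> (\<integral>p. B \<partial>M)"
      by (intro integral_mono integrable_abs int1 z) (simp_all add: bound_upd z)
    finally show ?thesis by (simp add: prob_space)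
  qed
  have f'_diff: "\<bar>f' z - f' (z(i := p))\<bar> \<le> c" if i: "i < m" and z: "z \<in> space ?P" and p: "p \<in> space M" for i z p
  proof -
    have z': "z(i := p) \<in> space ?P"
      using that by (auto simp: space_PiM PiE_iff extensional_def)
    have "\<bar>f' z - f' (z(i := p))\<bar> = \<bar>\<integral>q. f (z(m := q)) - f (z(i := p, m := q)) \<partial>M\<bar>"
      unfolding f'_def by (subst Bochner_Integration.integral_diff) (auto intro: int1 z z')
    also have "\<dots> \<le> (\<integral>q. \<bar>f (z(m := q)) - f (z(i := p, m := q))\<bar> \<partial>M)"
      by (rule integral_abs_bound)
    also have "\<dots> \<le> (\<integral>q. c \<partial>M)"
    proof (intro integral_mono integrable_abs Bochner_Integration.integrable_diff int1 z z')
      fix q assume q: "q \<in> space M"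
      have "z(i := p, m := q) = z(m := q, i := p)"
        using i fun_upd_twist[of i m z p q] by simp
      then show "\<bar>f (z(m := q)) - f (z(i := p, m := q))\<bar> \<le> c"
        using diff[OF less_SucI[OF i] upd[OF z q] p] by (simp only:)
    qed auto
    finally show ?thesis by (simp add: prob_space)
  qed
  have int_f: "integrable ?Q f"
    by (rule Q.integrable_const_bound, rule AE_I2, simp, rule bound, assumption) auto
  have E_eq: "(\<integral>z. f z \<partial>?Q) = (\<integral>z. f' z \<partial>?P)"
    unfolding f'_def by (rule integral_PiM_lessThan_Suc[OF int_f])
  define e where "e = (\<integral>z. f' z \<partial>?P)"
  have inner: "(\<integral>p. exp (s * (f (z(m := p)) - e)) \<partial>M) \<le> exp (s * (f' z - e)) * exp (s\<^sup>2 * c\<^sup>2 / 8)"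
    if z: "z \<in> space ?P" for z
  proof -
    \<comment> \<open>The interval moves with \<open>z\<close>, but its width is \<open>c\<close>
      for every \<open>z\<close>, and only the width enters Hoeffding's lemma.\<close>
    define a where "a = (INF p\<in>space M. f (z(m := p)))"
    have bdd: "bdd_below ((\<lambda>p. f (z(m := p))) ` space M)"
    proof (rule bdd_belowI2)
      fix p assume "p \<in> space M"
      then show "- B \<le> f (z(m := p))"
        using bound_upd[OF z, of p] by linarith
    qed
    have a: "f (z(m := p)) \<in> {a..a + c}" if p: "p \<in> space M" for p
    proof -
      have "f (z(m := p)) - c \<le> a"
        unfolding a_def
      proof (rule cINF_greatest)
        fix q assume "q \<in> space M"
        then have "\<bar>f (z(m := p)) - f (z(m := q))\<bar> \<le> c"
          using diff[OF lessI upd[OF z p], of q] by (simp only: fun_upd_upd)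
        then show "f (z(m := p)) - c \<le> f (z(m := q))"
          by linarith
      qed (rule not_empty)
      moreover have "a \<le> f (z(m := p))"
        unfolding a_def by (rule cINF_lower[OF bdd p])
      ultimately show ?thesis by simp
    qed
    interpret interval_bounded_random_variable M "\<lambda>p. f (z(m := p))" a "a + c"
      by unfold_locales (use a meas1[OF z] in auto)
    have "(\<integral>\<^sup>+p. exp (s * (f (z(m := p)) - f' z)) \<partial>M) \<le> ennreal (exp (s\<^sup>2 * c\<^sup>2 / 8))"
      using Hoeffdings_lemma_nn_integral[OF \<open>s > 0\<close>] by (simp add: f'_def)
    then have "(\<integral>p. exp (s * (f (z(m := p)) - f' z)) \<partial>M) \<le> exp (s\<^sup>2 * c\<^sup>2 / 8)"
      using meas1[OF z] by (subst integral_eq_nn_integral) (auto intro!: enn2real_leI)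
    then have "exp (s * (f' z - e)) * (\<integral>p. exp (s * (f (z(m := p)) - f' z)) \<partial>M)
        \<le> exp (s * (f' z - e)) * exp (s\<^sup>2 * c\<^sup>2 / 8)"
      by simp
    moreover have "exp (s * (f (z(m := p)) - e)) = exp (s * (f' z - e)) * exp (s * (f (z(m := p)) - f' z))" for p
      by (simp add: algebra_simps flip: exp_add)
    ultimately show ?thesis by simp
  qed
  have exp_bound: "norm (exp (s * (u - e))) \<le> exp (s * (B + \<bar>e\<bar>))" if "\<bar>u\<bar> \<le> B" for u
    using that \<open>s > 0\<close> by simp
  have "(\<integral>z. exp (s * (f z - e)) \<partial>?Q) = (\<integral>z. \<integral>p. exp (s * (f (z(m := p)) - e)) \<partial>M \<partial>?P)"
    by (rule integral_PiM_lessThan_Suc, rule Q.integrable_const_bound, rule AE_I2,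
        rule exp_bound, rule bound) auto
  also have "\<dots> \<le> (\<integral>z. exp (s * (f' z - e)) * exp (s\<^sup>2 * c\<^sup>2 / 8) \<partial>?P)"
  proof (rule integral_mono')
    show "integrable ?P (\<lambda>z. exp (s * (f' z - e)) * exp (s\<^sup>2 * c\<^sup>2 / 8))"
      by (rule integrable_mult_left, rule P.integrable_const_bound, rule AE_I2,
          rule exp_bound, rule f'_bound) auto
  qed (auto simp: inner)
  also have "\<dots> = (\<integral>z. exp (s * (f' z - e)) \<partial>?P) * exp (s\<^sup>2 * c\<^sup>2 / 8)"
    by simp
  also have "\<dots> \<le> exp (s\<^sup>2 * c\<^sup>2 * real m / 8) * exp (s\<^sup>2 * c\<^sup>2 / 8)"
    unfolding e_def by (intro mult_right_mono Suc.IH f'_meas f'_bound f'_diff) auto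
  also have "\<dots> = exp (s\<^sup>2 * c\<^sup>2 * real (Suc m) / 8)"
    by (simp add: field_simps flip: exp_add)
  finally show ?case by (simp add: E_eq e_def)
qed

theorem mcdiarmid:
  fixes f :: "(nat \<Rightarrow> 'a) \<Rightarrow> real"
  assumes meas [measurable]: "f \<in> borel_measurable (PiM {..<m} (\<lambda>_. M))"
    and bound: "\<And>z. z \<in> space (PiM {..<m} (\<lambda>_. M)) \<Longrightarrow> \<bar>f z\<bar> \<le> B"
    and diff: "\<And>i z p. i < m \<Longrightarrow> z \<in> space (PiM {..<m} (\<lambda>_. M)) \<Longrightarrow> p \<in> space M \<Longrightarrow>
            \<bar>f z - f (z(i := p))\<bar> \<le> c"
    and "c > 0" "m > 0" "\<epsilon> > 0"
  defines "P \<equiv> PiM {..<m} (\<lambda>_. M)"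
  shows "measure P {z\<in>space P. f z \<ge> (\<integral>z. f z \<partial>P) + \<epsilon>} \<le> exp (- 2 * \<epsilon>\<^sup>2 / (real m * c\<^sup>2))"
proof -
  interpret P: prob_space P unfolding P_def by (rule prob_space_PiM_iid)
  note [measurable] = meas[folded P_def]
  define e where "e = (\<integral>z. f z \<partial>P)"
  \<comment> \<open>Minimizes the exponent
    \<open>s\<^sup>2 * c\<^sup>2 * m / 8 - s * \<epsilon>\<close> that Markov's inequality for
    \<open>exp (s * (f z - e))\<close> produces.\<close>
  define s where "s = 4 * \<epsilon> / (real m * c\<^sup>2)"
  have s: "s > 0" using assms by (simp add: s_def)
  have exp_bound: "norm (exp (s * (u - e))) \<le> exp (s * (B + \<bar>e\<bar>))" if "\<bar>u\<bar> \<le> B" for u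
    using that s by simp
  have int: "integrable P (\<lambda>z. exp (s * (f z - e)))"
    by (rule P.integrable_const_bound, rule AE_I2, rule exp_bound, rule bound) (auto simp: P_def[symmetric])
  have "measure P {z\<in>space P. f z \<ge> e + \<epsilon>} = measure P {z\<in>space P. exp (s * (f z - e)) \<ge> exp (s * \<epsilon>)}"
    using s by (intro arg_cong[where f="measure P"]) auto
  also have "\<dots> \<le> (\<integral>z. exp (s * (f z - e)) \<partial>P) / exp (s * \<epsilon>)"
    by (rule integral_Markov_inequality_measure[OF int, where A="space P", simplified]) auto
  also have "\<dots> \<le> exp (s\<^sup>2 * c\<^sup>2 * real m / 8) / exp (s * \<epsilon>)"
    unfolding e_def P_def
    by (intro divide_right_mono mcdiarmid_mgf[where B=B] meas bound diff s) auto
  also have "\<dots> = exp (s\<^sup>2 * c\<^sup>2 * real m / 8 - s * \<epsilon>)"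
    by (simp add: exp_diff)
  also have "s\<^sup>2 * c\<^sup>2 * real m / 8 - s * \<epsilon> = - 2 * \<epsilon>\<^sup>2 / (real m * c\<^sup>2)"
    using assms by (simp add: s_def field_simps power2_eq_square)
  finally show ?thesis by (simp add: e_def)
qed

end

section \<open>Symmetrization and contraction\<close>

text \<open>A real \<open>SUP\<close> is meaningful only over a bounded range. One constant for all
  indices and points secures this at every point, and the integrability of the supremum too; hiding
  it behind an existential lets the closure rules act as introduction rules without tracking
  constants.\<close>

definition bounded_class :: "'a measure \<Rightarrow> ('k \<Rightarrow> 'a \<Rightarrow> real) \<Rightarrow> bool" where
  "bounded_class M u \<longleftrightarrow> (\<exists>C. \<forall>k. \<forall>x\<in>space M. \<bar>u k x\<bar> \<le> C)"

lemma bounded_classI: "(\<And>k x. x \<in> space M \<Longrightarrow> \<bar>u k x\<bar> \<le> C) \<Longrightarrow> bounded_class M u"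
  unfolding bounded_class_def by blast

lemma bounded_class_add:
  assumes "bounded_class M u" "bounded_class M v"
  shows "bounded_class M (\<lambda>k x. u k x + v k x)"
proof -
  obtain C D where "\<And>k x. x \<in> space M \<Longrightarrow> \<bar>u k x\<bar> \<le> C" "\<And>k x. x \<in> space M \<Longrightarrow> \<bar>v k x\<bar> \<le> D"
    using assms unfolding bounded_class_def by blast
  then show ?thesis
    by (intro bounded_classI[where C = "C + D"] order_trans[OF abs_triangle_ineq] add_mono) auto
qed

lemma bounded_class_cmult:
  assumes "bounded_class M u"
  shows "bounded_class M (\<lambda>k x. c * u k x)"
proof -
  obtain C where "\<And>k x. x \<in> space M \<Longrightarrow> \<bar>u k x\<bar> \<le> C"
    using assms unfolding bounded_class_def by blast
  then show ?thesis
    by (intro bounded_classI[where C = "\<bar>c\<bar> * C"]) (auto simp: abs_mult intro!: mult_left_mono)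
qed

lemma bounded_class_diff:
  assumes "bounded_class M u" "bounded_class M v"
  shows "bounded_class M (\<lambda>k x. u k x - v k x)"
  using bounded_class_add[OF assms(1) bounded_class_cmult[OF assms(2), of "-1"]] by simp

lemma bounded_class_sum:
  assumes "\<And>i. i \<in> I \<Longrightarrow> bounded_class M (u i)"
  shows "bounded_class M (\<lambda>k x. \<Sum>i\<in>I. u i k x)"
  using assms
proof (induction I rule: infinite_finite_induct)
  case (insert i I)
  then show ?case by (simp add: bounded_class_add)
qed (auto intro: bounded_classI[where C=0])

lemma measurable_PiM_component_compose:
  assumes "i \<in> I" "u \<in> measurable M N"
  shows "(\<lambda>z. u (z i)) \<in> measurable (PiM I (\<lambda>_. M)) N"
  by (rule measurable_compose[OF measurable_component_singleton[OF assms(1)] assms(2)])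

lemma bounded_class_PiM_component:
  assumes "bounded_class M u" "i \<in> I"
  shows "bounded_class (PiM I (\<lambda>_. M)) (\<lambda>k z. u k (z i))"
proof -
  have "z i \<in> space M" if "z \<in> space (PiM I (\<lambda>_. M))" for z
    using that assms(2) by (auto simp: space_PiM)
  then show ?thesis
    using assms(1) unfolding bounded_class_def by blast
qed

lemmas bounded_class_intros =
  bounded_class_add bounded_class_diff bounded_class_cmult bounded_class_sum bounded_class_PiM_component

lemma bounded_class_bdd_above:
  assumes "bounded_class M u" "x \<in> space M"
  shows "bdd_above (range (\<lambda>k. u k x))"
proof -
  obtain C where "\<And>k x. x \<in> space M \<Longrightarrow> \<bar>u k x\<bar> \<le> C"
    using assms unfolding bounded_class_def by blast
  then show ?thesis
    using assms(2) by (intro bdd_aboveI2[where M=C]) (auto simp: abs_le_iff)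
qed

lemma abs_SUP_le:
  fixes u :: "'k \<Rightarrow> real"
  assumes "\<And>k. \<bar>u k\<bar> \<le> C"
  shows "\<bar>SUP k. u k\<bar> \<le> C"
proof -
  have u: "- C \<le> u k" "u k \<le> C" for k
    using assms[of k] by linarith+
  have "(SUP k. u k) \<le> C"
    by (rule cSUP_least) (auto simp: u)
  moreover have "- C \<le> (SUP k. u k)"
    by (rule cSUP_upper2[where x=undefined]) (auto simp: u intro!: bdd_aboveI2[where M=C])
  ultimately show ?thesis by linarith
qed

lemma measurable_SUP_bounded_class:
  fixes u :: "nat \<Rightarrow> 'a \<Rightarrow> real"
  assumes "bounded_class M u" "\<And>k. u k \<in> borel_measurable M"
  shows "(\<lambda>x. SUP k. u k x) \<in> borel_measurable M"
  using assms by (intro borel_measurable_cSUP bounded_class_bdd_above) auto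

lemma (in prob_space) integrable_SUP_bounded_class:
  fixes u :: "nat \<Rightarrow> 'a \<Rightarrow> real"
  assumes "bounded_class M u" "\<And>k. u k \<in> borel_measurable M"
  shows "integrable M (\<lambda>x. SUP k. u k x)"
proof -
  obtain C where "\<And>k x. x \<in> space M \<Longrightarrow> \<bar>u k x\<bar> \<le> C"
    using assms unfolding bounded_class_def by blast
  then show ?thesis
    using measurable_SUP_bounded_class[OF assms]
    by (intro integrable_const_bound[where B=C]) (auto intro!: abs_SUP_le)
qed

lemma sum_PiE_lessThan_Suc:
  fixes F :: "(nat \<Rightarrow> 'b) \<Rightarrow> 'c::comm_monoid_add"
  shows "(\<Sum>\<sigma>\<in>{..<Suc m} \<rightarrow>\<^sub>E S. F \<sigma>) = (\<Sum>\<tau>\<in>S. \<Sum>\<sigma>\<in>{..<m} \<rightarrow>\<^sub>E S. F (\<sigma>(m := \<tau>)))"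
proof -
  have "(\<Sum>\<sigma>\<in>{..<Suc m} \<rightarrow>\<^sub>E S. F \<sigma>) = (\<Sum>(\<tau>, \<sigma>)\<in>S \<times> ({..<m} \<rightarrow>\<^sub>E S). F (\<sigma>(m := \<tau>)))"
    unfolding lessThan_Suc PiE_insert_eq
    by (subst sum.reindex[OF inj_combinator]) (auto simp: case_prod_unfold)
  then show ?thesis
    by (simp add: sum.cartesian_product)
qed

text \<open>The supremum is 1-Lipschitz for the sup norm; this transfers bounded differences from
  single hypotheses to the uniform deviation.\<close>

lemma abs_SUP_diff_le:
  fixes u v :: "'k \<Rightarrow> real"
  assumes "bdd_above (range u)" "bdd_above (range v)" "\<And>k. \<bar>u k - v k\<bar> \<le> c"
  shows "\<bar>(SUP k. u k) - (SUP k. v k)\<bar> \<le> c"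
proof -
  have "u k \<le> (SUP k. v k) + c" "v k \<le> (SUP k. u k) + c" for k
    using cSUP_upper[OF UNIV_I assms(1), of k] cSUP_upper[OF UNIV_I assms(2), of k] assms(3)[of k]
    by linarith+
  then have "(SUP k. u k) \<le> (SUP k. v k) + c" "(SUP k. v k) \<le> (SUP k. u k) + c"
    by (auto intro!: cSUP_least)
  then show ?thesis by linarith
qed

text \<open>The index is a natural number so that suprema over the class are measurable. In the
  application \<open>h\<close> is the margin, with the label already absorbed, and
  \<open>\<phi>\<close> is the hinge as a function of one variable.\<close>

locale lipschitz_loss_class = prob_space M for M :: "'a measure" +
  fixes h :: "nat \<Rightarrow> 'a \<Rightarrow> real" and \<phi> :: "real \<Rightarrow> real"
  assumes h_measurable [measurable]: "h k \<in> borel_measurable M"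
    and h_bounded: "bounded_class M h"
    and \<phi>_lipschitz: "\<bar>\<phi> u - \<phi> v\<bar> \<le> \<bar>u - v\<bar>"
begin

definition loss :: "nat \<Rightarrow> 'a \<Rightarrow> real" where
  "loss k p = \<phi> (h k p)"

definition mean_loss :: "nat \<Rightarrow> real" where
  "mean_loss k = (\<integral>p. loss k p \<partial>M)"

lemma \<phi>_measurable [measurable]: "\<phi> \<in> borel_measurable borel"
proof -
  have "1-lipschitz_on UNIV \<phi>"
    by (rule lipschitz_onI) (auto simp: dist_real_def \<phi>_lipschitz)
  then show ?thesis
    by (intro borel_measurable_continuous_onI lipschitz_on_continuous_on)
qed

lemma loss_measurable [measurable]: "loss k \<in> borel_measurable M"
  unfolding loss_def by measurable

lemma loss_bounded: "bounded_class M loss"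
proof -
  obtain C where C: "\<And>k x. x \<in> space M \<Longrightarrow> \<bar>h k x\<bar> \<le> C"
    using h_bounded unfolding bounded_class_def by blast
  show ?thesis
  proof (rule bounded_classI)
    fix k x assume "x \<in> space M"
    then show "\<bar>loss k x\<bar> \<le> \<bar>\<phi> 0\<bar> + C"
      using C[of x k] \<phi>_lipschitz[of "h k x" 0] by (simp add: loss_def)
  qed
qed

lemma loss_integrable: "integrable M (loss k)"
proof -
  obtain C where "\<And>k x. x \<in> space M \<Longrightarrow> \<bar>loss k x\<bar> \<le> C"
    using loss_bounded unfolding bounded_class_def by blast
  then show ?thesis
    by (intro integrable_const_bound[where B=C]) auto
qed

lemma mean_loss_bounded: "bounded_class N (\<lambda>k _. mean_loss k)"
proof -
  obtain C where C: "\<And>k x. x \<in> space M \<Longrightarrow> \<bar>loss k x\<bar> \<le> C"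
    using loss_bounded unfolding bounded_class_def by blast
  show ?thesis
  proof (rule bounded_classI)
    fix k
    have "\<bar>mean_loss k\<bar> \<le> (\<integral>p. \<bar>loss k p\<bar> \<partial>M)"
      unfolding mean_loss_def by (rule integral_abs_bound)
    also have "\<dots> \<le> (\<integral>p. C \<partial>M)"
      by (intro integral_mono integrable_abs loss_integrable) (auto simp: C)
    finally show "\<bar>mean_loss k\<bar> \<le> C" by (simp add: prob_space)
  qed
qed

text \<open>
  Splitting the supremum of a sum into two halves, one carrying the mean and one the observed loss,
  symmetrizes a single coordinate without an independent copy of it. The average over both signs
  then permits contraction, as only pairs \<open>\<phi> (h k p) - \<phi> (h l p)\<close> occur.
\<close>
lemma symmetrize_contract_step:
  assumes b: "\<And>k. \<bar>b k\<bar> \<le> (C::real)"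
  shows "(\<integral>p. (SUP k. b k + (mean_loss k - loss k p)) \<partial>M)
           \<le> (\<integral>p. (\<Sum>\<tau>\<in>{-1, 1}. SUP k. b k + 2 * (\<tau> * h k p)) / 2 \<partial>M)"
proof -
  have b_bounded: "bounded_class M (\<lambda>k _. b k)"
    using b by (rule bounded_classI)
  have bdd_b: "bounded_class M (\<lambda>k p. b k + (mean_loss k - loss k p))"
      "bounded_class M (\<lambda>k p. b k + 2 * loss k p)"
      "bounded_class M (\<lambda>k p. b k - 2 * loss k p)"
      "bounded_class M (\<lambda>k p. b k + 2 * mean_loss k)"
      "bounded_class M (\<lambda>k p. b k + 2 * (\<tau> * h k p))" for \<tau>
    by (intro bounded_class_intros b_bounded loss_bounded mean_loss_bounded h_bounded)+
  note bdd = bdd_b[THEN bounded_class_bdd_above]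
  let ?Sp = "\<lambda>p. SUP k. b k + 2 * loss k p" and ?Sm = "\<lambda>p. SUP k. b k - 2 * loss k p"
  let ?T = "\<lambda>\<tau> p. SUP k. b k + 2 * (\<tau> * h k p)"
  have int: "integrable M (\<lambda>p. SUP k. b k + (mean_loss k - loss k p))"
      "integrable M ?Sp" "integrable M ?Sm" "integrable M (?T \<tau>)" for \<tau>
    by (intro integrable_SUP_bounded_class bdd_b; measurable)+
  \<comment> \<open>A supremum of integrals is at most the integral of the supremum; this replaces
    the second sample of the usual symmetrization.\<close>
  have mean: "(SUP k. b k + 2 * mean_loss k) \<le> (\<integral>p. ?Sp p \<partial>M)"
  proof (rule cSUP_least)
    fix k
    have "b k + 2 * mean_loss k = (\<integral>p. b k + 2 * loss k p \<partial>M)"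
      unfolding mean_loss_def
      by (subst Bochner_Integration.integral_add) (auto intro!: loss_integrable simp: prob_space)
    also have "\<dots> \<le> (\<integral>p. ?Sp p \<partial>M)"
      by (intro integral_mono Bochner_Integration.integrable_add integrable_mult_right loss_integrable int
          cSUP_upper bdd) auto
    finally show "b k + 2 * mean_loss k \<le> (\<integral>p. ?Sp p \<partial>M)" .
  qed simp
  \<comment> \<open>Each term is half of \<open>b k + 2 * mean_loss k\<close> plus half of
    \<open>b k - 2 * loss k p\<close>, and each half is bounded by its own supremum. The doubling is
    the factor 2 of symmetrization.\<close>
  have "(\<integral>p. (SUP k. b k + (mean_loss k - loss k p)) \<partial>M) \<le> (\<integral>p. ((\<integral>p. ?Sp p \<partial>M) + ?Sm p) / 2 \<partial>M)"
  proof (intro integral_mono int integrable_divide Bochner_Integration.integrable_add integrable_const)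
    fix p assume p: "p \<in> space M"
    show "(SUP k. b k + (mean_loss k - loss k p)) \<le> ((\<integral>p. ?Sp p \<partial>M) + ?Sm p) / 2"
    proof (rule cSUP_least)
      fix k
      have "b k + 2 * mean_loss k \<le> (\<integral>p. ?Sp p \<partial>M)"
        by (rule order_trans[OF cSUP_upper[OF UNIV_I bdd(4)[OF p]] mean])
      moreover have "b k - 2 * loss k p \<le> ?Sm p"
        by (rule cSUP_upper[OF UNIV_I bdd(3)[OF p]])
      ultimately show "b k + (mean_loss k - loss k p) \<le> ((\<integral>p. ?Sp p \<partial>M) + ?Sm p) / 2"
        by argo
    qed simp
  qed
  also have "\<dots> = (\<integral>p. (?Sp p + ?Sm p) / 2 \<partial>M)"
    using int by (simp add: prob_space)
  also have "\<dots> \<le> (\<integral>p. (?T (-1) p + ?T 1 p) / 2 \<partial>M)"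
  proof (intro integral_mono int integrable_divide Bochner_Integration.integrable_add)
    fix p assume p: "p \<in> space M"
    let ?t = "?T (-1) p + ?T 1 p"
    \<comment> \<open>The loss difference is at most \<open>\<bar>h k p - h l p\<bar>\<close>.
      Whichever sign \<open>h k p - h l p\<close> has, one of the two ways of giving
      \<open>k\<close> and \<open>l\<close> opposite signs attains the absolute value, and
      \<open>?t\<close> dominates both.\<close>
    have pair: "(b k + 2 * loss k p) + (b l - 2 * loss l p) \<le> ?t" for k l
    proof -
      have "loss k p - loss l p \<le> \<bar>h k p - h l p\<bar>"
        using \<phi>_lipschitz[of "h k p" "h l p"] by (simp add: loss_def)
      moreover have "b j + 2 * (1 * h j p) \<le> ?T 1 p" "b j + 2 * (-1 * h j p) \<le> ?T (-1) p" for j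
        by (rule cSUP_upper[OF UNIV_I bdd(5)[OF p]])+
      from this[of k] this[of l] have "b k + 2 * h k p + (b l - 2 * h l p) \<le> ?t" "b l + 2 * h l p + (b k - 2 * h k p) \<le> ?t"
        by linarith+
      ultimately show ?thesis by linarith
    qed
    have "b l - 2 * loss l p \<le> ?t - ?Sp p" for l
    proof -
      have "?Sp p \<le> ?t - (b l - 2 * loss l p)"
      proof (rule cSUP_least)
        fix k
        show "b k + 2 * loss k p \<le> ?t - (b l - 2 * loss l p)"
          using pair[of k l] by linarith
      qed simp
      then show ?thesis by linarith
    qed
    then have "?Sm p \<le> ?t - ?Sp p"
      by (intro cSUP_least) auto
    then show "(?Sp p + ?Sm p) / 2 \<le> ?t / 2"
      by argo
  qed
  finally show ?thesis by simp
qed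

theorem symmetrize_contract:
  assumes "\<And>k. \<bar>b k\<bar> \<le> (C::real)"
  shows "(\<integral>z. (SUP k. b k + (\<Sum>i<m. mean_loss k - loss k (z i))) \<partial>PiM {..<m} (\<lambda>_. M))
      \<le> (\<integral>z. (\<Sum>\<sigma>\<in>{..<m} \<rightarrow>\<^sub>E {-1, 1}. SUP k. b k + 2 * (\<Sum>i<m. \<sigma> i * h k (z i))) / 2 ^ m
            \<partial>PiM {..<m} (\<lambda>_. M))"
  using assms
proof (induction m arbitrary: b C)
  case 0
  then show ?case by simp
next
  case (Suc m)
  let ?P = "PiM {..<m} (\<lambda>_. M)" and ?Q = "PiM {..<Suc m} (\<lambda>_. M)"
  interpret P: prob_space ?P by (rule prob_space_PiM_iid)
  interpret Q: prob_space ?Q by (rule prob_space_PiM_iid)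
  have comp [measurable]: "(\<lambda>z. u (z i)) \<in> borel_measurable (PiM I (\<lambda>_. M))"
    if "i \<in> I" "u \<in> borel_measurable M" for u :: "'a \<Rightarrow> real" and i and I :: "nat set"
    using that by (rule measurable_PiM_component_compose)
  have b_bounded: "bounded_class N (\<lambda>k _. b k)" for N :: "'c measure"
    using Suc.prems by (rule bounded_classI)
  define S where "S k z = (\<Sum>i<m. mean_loss k - loss k (z i))" for k z
  have S_measurable [measurable]: "S k \<in> borel_measurable ?P" "S k \<in> borel_measurable ?Q" for k
    unfolding S_def by measurable auto
  have S_bounded: "bounded_class ?P S" "bounded_class ?Q S"
    unfolding S_def by (intro bounded_class_intros mean_loss_bounded loss_bounded; simp)+
  define R where "R \<sigma> k z = (\<Sum>i<m. \<sigma> i * h k (z i))" for \<sigma> :: "nat \<Rightarrow> real" and k z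
  have R_measurable [measurable]: "R \<sigma> k \<in> borel_measurable ?P" "R \<sigma> k \<in> borel_measurable ?Q" for \<sigma> k
    unfolding R_def by measurable auto
  have R_bounded: "bounded_class ?P (R \<sigma>)" "bounded_class ?Q (R \<sigma>)" for \<sigma>
    unfolding R_def by (intro bounded_class_intros h_bounded; simp)+
  have upd: "S k (z(m := p)) = S k z" "R \<sigma> k (z(m := p)) = R \<sigma> k z" "R (\<sigma>(m := \<tau>)) k z = R \<sigma> k z"
    for k z p \<sigma> \<tau>
    by (simp_all add: S_def R_def)
  \<comment> \<open>\<open>G1\<close>, \<open>G2\<close> and \<open>G3\<close> are the integrand
    with no signs, with a sign on the last coordinate only, and with signs on all
    coordinates.\<close>
  define G1 where "G1 z = (SUP k. b k + S k z + (mean_loss k - loss k (z m)))" for z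
  define G2 where "G2 z = (\<Sum>\<tau>\<in>{-1, 1}. SUP k. b k + S k z + 2 * (\<tau> * h k (z m))) / 2" for z
  define G3 where "G3 z = (\<Sum>\<tau>\<in>{-1, 1}. (\<Sum>\<sigma>\<in>{..<m} \<rightarrow>\<^sub>E {-1, 1}.
      SUP k. b k + 2 * (\<tau> * h k (z m)) + 2 * R \<sigma> k z) / 2 ^ m) / 2" for z
  note bdd = bounded_class_add bounded_class_diff bounded_class_cmult b_bounded S_bounded R_bounded
    mean_loss_bounded bounded_class_PiM_component[OF loss_bounded] bounded_class_PiM_component[OF h_bounded]
  have G1: "integrable ?Q G1"
    unfolding G1_def
  proof (rule Q.integrable_SUP_bounded_class)
    show "bounded_class ?Q (\<lambda>k z. b k + S k z + (mean_loss k - loss k (z m)))"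
      by (intro bdd) simp
  qed measurable
  have G2: "integrable ?Q G2"
    unfolding G2_def
  proof (intro Bochner_Integration.integrable_divide Bochner_Integration.integrable_sum Q.integrable_SUP_bounded_class)
    show "bounded_class ?Q (\<lambda>k z. b k + S k z + 2 * (\<tau> * h k (z m)))" for \<tau>
      by (intro bdd) simp
  qed measurable
  have G3: "integrable ?Q G3"
    unfolding G3_def
  proof (intro Bochner_Integration.integrable_divide Bochner_Integration.integrable_sum Q.integrable_SUP_bounded_class)
    show "bounded_class ?Q (\<lambda>k z. b k + 2 * (\<tau> * h k (z m)) + 2 * R \<sigma> k z)" for \<tau> \<sigma>
      by (intro bdd) simp
  qed measurable
  have "(\<integral>z. (SUP k. b k + (\<Sum>i<Suc m. mean_loss k - loss k (z i))) \<partial>?Q) = (\<integral>z. G1 z \<partial>?Q)"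
    by (simp add: G1_def S_def add.assoc)
  also have "\<dots> = (\<integral>z. \<integral>p. G1 (z(m := p)) \<partial>M \<partial>?P)"
    by (rule integral_PiM_lessThan_Suc[OF G1])
  also have "\<dots> \<le> (\<integral>z. \<integral>p. G2 (z(m := p)) \<partial>M \<partial>?P)"
  proof (rule integral_mono[OF integrable_PiM_lessThan_Suc[OF G1] integrable_PiM_lessThan_Suc[OF G2]])
    fix z assume z: "z \<in> space ?P"
    obtain D where D: "\<And>k x. x \<in> space ?P \<Longrightarrow> \<bar>b k + S k x\<bar> \<le> D"
      using bounded_class_add[OF b_bounded S_bounded(1)] unfolding bounded_class_def by blast
    show "(\<integral>p. G1 (z(m := p)) \<partial>M) \<le> (\<integral>p. G2 (z(m := p)) \<partial>M)"
      unfolding G1_def G2_def upd fun_upd_same by (rule symmetrize_contract_step[OF D[OF z]])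
  qed
  \<comment> \<open>The single-coordinate step froze the first \<open>m\<close> coordinates; the
    induction hypothesis needs the last one frozen, so the order of integration is
    exchanged.\<close>
  also have "\<dots> = (\<integral>p. \<integral>z. G2 (z(m := p)) \<partial>?P \<partial>M)"
    by (simp only: integral_PiM_lessThan_Suc[OF G2, symmetric] integral_PiM_lessThan_Suc_rev[OF G2])
  also have "\<dots> \<le> (\<integral>p. \<integral>z. G3 (z(m := p)) \<partial>?P \<partial>M)"
  proof (rule integral_mono[OF integrable_PiM_lessThan_Suc_rev[OF G2] integrable_PiM_lessThan_Suc_rev[OF G3]])
    fix p assume p: "p \<in> space M"
    have bp: "bounded_class N (\<lambda>k _. b k + 2 * (\<tau> * h k p))" for \<tau> and N :: "'c measure"
    proof -
      have "bounded_class M (\<lambda>k p. b k + 2 * (\<tau> * h k p))"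
        by (intro bounded_class_intros b_bounded h_bounded)
      then show ?thesis
        using p unfolding bounded_class_def by blast
    qed
    have intS: "integrable ?P (\<lambda>z. SUP k. b k + 2 * (\<tau> * h k p) + S k z)" for \<tau>
      by (intro P.integrable_SUP_bounded_class bounded_class_add[OF bp] S_bounded) measurable
    have intR: "integrable ?P (\<lambda>z. (\<Sum>\<sigma>\<in>{..<m} \<rightarrow>\<^sub>E {-1, 1}. SUP k. b k + 2 * (\<tau> * h k p) + 2 * R \<sigma> k z) / 2 ^ m)" for \<tau>
      by (intro Bochner_Integration.integrable_divide Bochner_Integration.integrable_sum
          P.integrable_SUP_bounded_class bounded_class_add[OF bp] bounded_class_cmult R_bounded) measurable
    have IH: "(\<integral>z. (SUP k. b k + 2 * (\<tau> * h k p) + S k z) \<partial>?P)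
        \<le> (\<integral>z. (\<Sum>\<sigma>\<in>{..<m} \<rightarrow>\<^sub>E {-1, 1}. SUP k. b k + 2 * (\<tau> * h k p) + 2 * R \<sigma> k z) / 2 ^ m \<partial>?P)" for \<tau>
    proof -
      \<comment> \<open>The family is constant in its second argument, so any measure with nonempty
        space yields a bound valid for all \<open>k\<close>; \<open>count_space UNIV\<close> is
        one.\<close>
      obtain D where "\<And>k. \<bar>b k + 2 * (\<tau> * h k p)\<bar> \<le> D"
        using bp[of "count_space UNIV"] unfolding bounded_class_def by auto
      from Suc.IH[OF this] show ?thesis
        by (simp add: S_def R_def)
    qed
    have "(\<integral>z. G2 (z(m := p)) \<partial>?P) = (\<Sum>\<tau>\<in>{-1, 1}. \<integral>z. (SUP k. b k + 2 * (\<tau> * h k p) + S k z) \<partial>?P) / 2"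
    proof -
      have "G2 (z(m := p)) = (\<Sum>\<tau>\<in>{-1, 1}. SUP k. b k + 2 * (\<tau> * h k p) + S k z) / 2" for z
        unfolding G2_def upd fun_upd_same by (simp add: ac_simps)
      then show ?thesis
        by (simp only: integral_divide_zero Bochner_Integration.integral_sum[OF intS])
    qed
    also have "\<dots> \<le> (\<Sum>\<tau>\<in>{-1, 1}. \<integral>z. (\<Sum>\<sigma>\<in>{..<m} \<rightarrow>\<^sub>E {-1, 1}.
        SUP k. b k + 2 * (\<tau> * h k p) + 2 * R \<sigma> k z) / 2 ^ m \<partial>?P) / 2"
      by (intro divide_right_mono sum_mono IH) simp
    also have "\<dots> = (\<integral>z. G3 (z(m := p)) \<partial>?P)"
      unfolding G3_def upd fun_upd_same
      by (simp only: integral_divide_zero Bochner_Integration.integral_sum[OF intR])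
    finally show "(\<integral>z. G2 (z(m := p)) \<partial>?P) \<le> (\<integral>z. G3 (z(m := p)) \<partial>?P)" .
  qed
  also have "\<dots> = (\<integral>z. G3 z \<partial>?Q)"
    by (simp only: integral_PiM_lessThan_Suc_rev[OF G3])
  also have "\<dots> = (\<integral>z. (\<Sum>\<sigma>\<in>{..<Suc m} \<rightarrow>\<^sub>E {-1, 1}. SUP k. b k + 2 * (\<Sum>i<Suc m. \<sigma> i * h k (z i))) / 2 ^ Suc m \<partial>?Q)"
  proof (intro arg_cong[where f="integral\<^sup>L ?Q"] ext)
    fix z
    have "b k + 2 * (\<Sum>i<Suc m. (\<sigma>(m := \<tau>)) i * h k (z i)) = b k + 2 * (\<tau> * h k (z m)) + 2 * R \<sigma> k z" for k \<tau> \<sigma>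
      by (simp add: R_def)
    then show "G3 z = (\<Sum>\<sigma>\<in>{..<Suc m} \<rightarrow>\<^sub>E {-1, 1}. SUP k. b k + 2 * (\<Sum>i<Suc m. \<sigma> i * h k (z i))) / 2 ^ Suc m"
      unfolding sum_PiE_lessThan_Suc G3_def by (simp only: sum_divide_distrib[symmetric]) simp
  qed
  finally show ?case .
qed

text \<open>McDiarmid's inequality concentrates the supremum of the deviations around its mean, and
  \<open>symmetrize_contract\<close> with zero offset bounds that mean. The event is the complement
  of the tail event of the supremum, so it serves all \<open>k\<close> at once.\<close>

theorem uniform_deviation:
  assumes h_bound: "\<And>k p. p \<in> space M \<Longrightarrow> \<bar>h k p\<bar> \<le> B"
    and pos: "B > 0" "m > 0" "0 < \<delta>" "\<delta> < 1"
  defines "P \<equiv> PiM {..<m} (\<lambda>_. M)"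
  shows "\<exists>E\<in>sets P. measure P E \<ge> 1 - \<delta> \<and>
    (\<forall>z\<in>E. \<forall>k. mean_loss k - (1 / real m) * (\<Sum>i<m. loss k (z i))
       \<le> (\<integral>z. (\<Sum>\<sigma>\<in>{..<m} \<rightarrow>\<^sub>E {-1, 1}. SUP k. 2 * (\<Sum>i<m. \<sigma> i * h k (z i))) / 2 ^ m \<partial>P) / real m
          + B * sqrt (2 * ln (1 / \<delta>) / real m))"
proof -
  interpret P: prob_space P
    unfolding P_def by (rule prob_space_PiM_iid)
  define S where "S k z = (\<Sum>i<m. mean_loss k - loss k (z i))" for k z
  have S_measurable [measurable]: "S k \<in> borel_measurable P" for k
    unfolding S_def P_def
    by (intro borel_measurable_sum borel_measurable_diff borel_measurable_const
        measurable_PiM_component_compose loss_measurable)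
  have S_bounded: "bounded_class P S"
    unfolding S_def P_def
    by (intro bounded_class_sum bounded_class_diff mean_loss_bounded
        bounded_class_PiM_component[OF loss_bounded])
  note S_bounded' = bounded_class_cmult[OF S_bounded, of "1 / real m"]
  define f where "f z = (SUP k. 1 / real m * S k z)" for z
  define T where "T = (\<integral>z. (\<Sum>\<sigma>\<in>{..<m} \<rightarrow>\<^sub>E {-1, 1}. SUP k. 2 * (\<Sum>i<m. \<sigma> i * h k (z i))) / 2 ^ m \<partial>P)"
  \<comment> \<open>Solves
    \<open>2 * \<epsilon>\<^sup>2 / (m * c\<^sup>2) = ln (1 / \<delta>)\<close> for McDiarmid's
    constant \<open>c = 2 * B / m\<close>.\<close>
  define \<epsilon> where "\<epsilon> = B * sqrt (2 * ln (1 / \<delta>) / real m)"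
  have f_measurable [measurable]: "f \<in> borel_measurable P"
    unfolding f_def by (rule measurable_SUP_bounded_class[OF S_bounded']) measurable
  obtain C where C: "\<And>k x. x \<in> space P \<Longrightarrow> \<bar>1 / real m * S k x\<bar> \<le> C"
    using S_bounded' unfolding bounded_class_def by blast
  have f_upper: "1 / real m * S k z \<le> f z" if "z \<in> space P" for k z
    unfolding f_def by (rule cSUP_upper[OF UNIV_I bounded_class_bdd_above[OF S_bounded' that]])
  have f_diff: "\<bar>f z - f (z(i := p))\<bar> \<le> 2 * B / real m" if i: "i < m" and z: "z \<in> space P" and p: "p \<in> space M" for i z p
  proof -
    have z': "z(i := p) \<in> space P"
      using i z p by (auto simp: P_def space_PiM PiE_iff extensional_def)
    have zi: "z i \<in> space M"
      using i z by (auto simp: P_def space_PiM)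
    have "\<bar>1 / real m * S k z - 1 / real m * S k (z(i := p))\<bar> \<le> 2 * B / real m" for k
    proof -
      have "S k z - S k (z(i := p)) = (\<Sum>j<m. if j = i then loss k p - loss k (z i) else 0)"
        unfolding S_def sum_subtractf[symmetric] by (intro sum.cong) auto
      also have "\<dots> = loss k p - loss k (z i)"
        using i by simp
      finally have "\<bar>S k z - S k (z(i := p))\<bar> \<le> \<bar>h k p - h k (z i)\<bar>"
        using \<phi>_lipschitz by (simp add: loss_def)
      also have "\<dots> \<le> 2 * B"
        using h_bound[OF p, of k] h_bound[OF zi, of k] by linarith
      finally have "1 / real m * \<bar>S k z - S k (z(i := p))\<bar> \<le> 1 / real m * (2 * B)"
        by (rule mult_left_mono) simp
      then show ?thesis
        by (simp flip: diff_divide_distrib)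
    qed
    then show ?thesis
      unfolding f_def
      by (rule abs_SUP_diff_le[OF bounded_class_bdd_above[OF S_bounded' z] bounded_class_bdd_above[OF S_bounded' z']])
  qed
  have f_bound: "\<bar>f z\<bar> \<le> C" if "z \<in> space P" for z
    unfolding f_def by (rule abs_SUP_le[OF C[OF that]])
  have int_f: "integrable P f"
    unfolding f_def by (rule P.integrable_SUP_bounded_class[OF S_bounded']) measurable
  have "(\<integral>z. f z \<partial>P) \<le> (\<integral>z. 1 / real m * (SUP k. S k z) \<partial>P)"
  proof (rule integral_mono[OF int_f])
    show "integrable P (\<lambda>z. 1 / real m * (SUP k. S k z))"
      by (intro integrable_mult_right P.integrable_SUP_bounded_class[OF S_bounded]) measurable
    fix z assume "z \<in> space P"
    then show "f z \<le> 1 / real m * (SUP k. S k z)"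
      unfolding f_def
      by (intro cSUP_least mult_left_mono cSUP_upper[OF UNIV_I] bounded_class_bdd_above[OF S_bounded]) simp_all
  qed
  also have "\<dots> \<le> T / real m"
    using divide_right_mono[OF symmetrize_contract[of "\<lambda>_. 0" 0 m], of "real m"]
    by (simp add: S_def T_def P_def)
  finally have mean: "(\<integral>z. f z \<partial>P) \<le> T / real m" .
  have "ln (1 / \<delta>) > 0"
    using pos by simp
  then have \<epsilon>: "\<epsilon> > 0" "\<epsilon>\<^sup>2 = B\<^sup>2 * (2 * ln (1 / \<delta>) / real m)"
    using pos by (simp_all add: \<epsilon>_def power_mult_distrib)
  let ?bad = "{z\<in>space P. f z \<ge> (\<integral>z. f z \<partial>P) + \<epsilon>}"
  have "measure P ?bad \<le> exp (- 2 * \<epsilon>\<^sup>2 / (real m * (2 * B / real m)\<^sup>2))"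
    by (rule mcdiarmid[where f=f and m=m, folded P_def, OF f_measurable f_bound f_diff]) (use pos \<epsilon>(1) in simp_all)
  also have "- 2 * \<epsilon>\<^sup>2 / (real m * (2 * B / real m)\<^sup>2) = ln \<delta>"
    unfolding \<epsilon>(2) using pos by (simp add: field_simps power2_eq_square ln_div)
  finally have "measure P ?bad \<le> \<delta>"
    using pos by simp
  then have "measure P (space P - ?bad) \<ge> 1 - \<delta>"
    by (subst P.prob_compl) auto
  moreover have "mean_loss k - (1 / real m) * (\<Sum>i<m. loss k (z i)) \<le> T / real m + \<epsilon>"
    if z: "z \<in> space P - ?bad" for z k
  proof -
    have "mean_loss k - (1 / real m) * (\<Sum>i<m. loss k (z i)) = 1 / real m * S k z"
      using \<open>m > 0\<close> by (simp add: S_def sum_subtractf field_simps)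
    also have "\<dots> \<le> f z"
      using z by (intro f_upper) simp
    also have "\<dots> \<le> (\<integral>z. f z \<partial>P) + \<epsilon>"
      using z by force
    finally show ?thesis
      using mean by simp
  qed
  ultimately show ?thesis
    unfolding T_def[symmetric] \<epsilon>_def[symmetric]
    by (intro bexI[of _ "space P - ?bad"] conjI ballI allI) measurable
qed

end

section \<open>Matrix norms and their duals\<close>

lemma trace_transpose_mult: "trace (transpose B ** A) = B \<bullet> (A :: real^'d^'d)"
  unfolding trace_def matrix_matrix_mult_def transpose_def inner_vec_def
  by (subst sum.swap) simp

text \<open>Makes the bilinear form linear in the matrix, so that dual norms of rank-one matrices
  control kernel values.\<close>

lemma inner_outer: "outer a b \<bullet> A = a \<bullet> (A *v b)"
  by (simp add: outer_def inner_vec_def matrix_vector_mult_def sum_distrib_left mult_ac)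

lemma outer_add_left: "outer (a + a') b = outer a b + outer a' b"
  by (simp add: outer_def vec_eq_iff algebra_simps)

lemma outer_scaleR_left: "outer (c *\<^sub>R a) b = c *\<^sub>R outer a b"
  by (simp add: outer_def vec_eq_iff)

lemma outer_sum_left: "outer (\<Sum>i\<in>I. a i) b = (\<Sum>i\<in>I. outer (a i) b)"
  by (simp add: outer_def vec_eq_iff sum_distrib_right)

lemma norm_outer: "norm (outer a b) = norm a * norm b"
proof -
  have "outer a b *v b = (b \<bullet> b) *\<^sub>R a"
    by (simp add: outer_def vec_eq_iff matrix_vector_mult_def inner_vec_def sum_distrib_left mult_ac)
  then have "outer a b \<bullet> outer a b = (norm a * norm b)\<^sup>2"
    by (simp add: inner_outer power_mult_distrib power2_norm_eq_inner mult.commute)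
  then show ?thesis
    by (simp add: norm_eq_sqrt_inner[of "outer a b"])
qed

lemma inner_matrix_symmetric:
  assumes "transpose A = (A :: real^'d^'d)"
  shows "a \<bullet> (A *v b) = b \<bullet> (A *v a)"
proof -
  have "a \<bullet> (A *v b) = (transpose A *v a) \<bullet> b"
    by (simp add: dot_lmul_matrix transpose_matrix_vector)
  then show ?thesis
    by (simp add: assms inner_commute)
qed

section \<open>Norm equivalence and duality\<close>

locale matrix_norm =
  fixes N :: "real^'d^'d \<Rightarrow> real"
  assumes is_matrix_norm: "is_matrix_norm N"
begin

lemma nonneg: "0 \<le> N A" and eq_0_iff: "N A = 0 \<longleftrightarrow> A = 0"
  and scaleR: "N (c *\<^sub>R A) = \<bar>c\<bar> * N A" and triangle: "N (A + B) \<le> N A + N B"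
  using is_matrix_norm unfolding is_matrix_norm_def by blast+

lemma zero [simp]: "N 0 = 0"
  by (simp add: eq_0_iff)

lemma minus: "N (- A) = N A"
  using scaleR[of "-1" A] by simp

lemma sum_le: "N (\<Sum>i\<in>I. A i) \<le> (\<Sum>i\<in>I. N (A i))"
proof (induction I rule: infinite_finite_induct)
  case (insert i I)
  then show ?case using triangle[of "A i" "\<Sum>i\<in>I. A i"] by simp
qed simp_all

lemma le_norm: "N A \<le> (\<Sum>b\<in>Basis. N b) * norm A"
proof -
  have "N A = N (\<Sum>b\<in>Basis. (A \<bullet> b) *\<^sub>R b)"
    by (simp add: euclidean_representation)
  also have "\<dots> \<le> (\<Sum>b\<in>Basis. \<bar>A \<bullet> b\<bar> * N b)"
    using sum_le[of "\<lambda>b. (A \<bullet> b) *\<^sub>R b" Basis] by (simp add: scaleR)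
  also have "\<dots> \<le> (\<Sum>b\<in>Basis. norm A * N b)"
    by (intro sum_mono mult_right_mono Basis_le_norm nonneg)
  finally show ?thesis by (simp add: sum_distrib_left mult.commute)
qed

lemma norm_continuous_on: "continuous_on S N"
proof -
  let ?C = "\<Sum>b\<in>Basis. N b"
  have "N A - N B \<le> ?C * norm (A - B)" for A B
    using triangle[of "A - B" B] le_norm[of "A - B"] by simp
  then have "\<bar>N A - N B\<bar> \<le> ?C * norm (A - B)" for A B
    by (metis abs_le_iff minus_diff_eq norm_minus_commute)
  then have "?C-lipschitz_on S N"
    by (intro lipschitz_onI) (auto simp: dist_norm nonneg intro: sum_nonneg)
  then show ?thesis
    by (rule lipschitz_on_continuous_on)
qed

text \<open>\<open>N\<close> is continuous and vanishes only at 0, hence has a positive minimum on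
  the compact Euclidean unit sphere. The resulting bound on the unit ball of \<open>N\<close> is
  what gives the real supremum in \<open>dual_norm\<close> its meaning.\<close>

lemma norm_le_ex: "\<exists>c>0. \<forall>A. norm A \<le> c * N A"
proof -
  have "sphere (0 :: real^'d^'d) 1 \<noteq> {}"
    by simp
  then obtain A0 where A0: "A0 \<in> sphere 0 1" "\<And>A. A \<in> sphere 0 1 \<Longrightarrow> N A0 \<le> N A"
    using continuous_attains_inf[OF compact_sphere _ norm_continuous_on] by metis
  have pos: "N A0 > 0"
    using A0(1) nonneg[of A0] eq_0_iff[of A0] by (auto simp: less_le)
  have "norm A \<le> 1 / N A0 * N A" for A
  proof (cases "A = 0")
    case False
    then have "N A0 \<le> N ((1 / norm A) *\<^sub>R A)"
      by (intro A0(2)) simp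
    then show ?thesis
      using False pos by (simp add: scaleR field_simps)
  qed simp
  then show ?thesis
    using pos by (intro exI[of _ "1 / N A0"]) auto
qed

lemma dual_norm_eq: "dual_norm N B = (SUP A\<in>{A. N A \<le> 1}. B \<bullet> A)"
  by (simp add: dual_norm_def trace_transpose_mult)

lemma unit_ball_nonempty: "{A. N A \<le> 1} \<noteq> {}"
  using eq_0_iff[of 0] by (intro ex_in_conv[THEN iffD1] exI[of _ 0]) simp

lemma inner_le_ex: "\<exists>c>0. \<forall>A B. N A \<le> 1 \<longrightarrow> B \<bullet> A \<le> c * norm B"
proof -
  obtain c where c: "c > 0" "\<And>A. norm A \<le> c * N A"
    using norm_le_ex by blast
  have "B \<bullet> A \<le> c * norm B" if "N A \<le> 1" for A B
  proof -
    have "norm A \<le> c * 1"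
      by (rule order_trans[OF c(2) mult_left_mono[OF that]]) (use c(1) in simp)
    then have "norm B * norm A \<le> norm B * c"
      by (intro mult_left_mono) auto
    then show ?thesis
      using norm_cauchy_schwarz[of B A] by (simp add: mult.commute)
  qed
  then show ?thesis using c(1) by blast
qed

lemma dual_norm_bdd_above: "bdd_above ((\<lambda>A. B \<bullet> A) ` {A. N A \<le> 1})"
proof -
  obtain c where "\<And>A. N A \<le> 1 \<Longrightarrow> B \<bullet> A \<le> c * norm B"
    using inner_le_ex by blast
  then show ?thesis
    by (intro bdd_aboveI2[where M="c * norm B"]) simp
qed

lemma dual_norm_le_ex: "\<exists>c>0. \<forall>B. dual_norm N B \<le> c * norm B"
proof -
  obtain c where "c > 0" "\<And>A B. N A \<le> 1 \<Longrightarrow> B \<bullet> A \<le> c * norm B"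
    using inner_le_ex by blast
  then show ?thesis
    unfolding dual_norm_eq by (intro exI[of _ c] conjI allI cSUP_least unit_ball_nonempty) auto
qed

text \<open>Hoelder's inequality for the dual pair of norms, by scaling \<open>A\<close> to
  \<open>N\<close>-norm 1.\<close>

lemma inner_le_dual_norm: "B \<bullet> A \<le> dual_norm N B * N A"
proof (cases "A = 0")
  case False
  then have pos: "N A > 0"
    using nonneg[of A] eq_0_iff[of A] by (simp add: less_le)
  have "B \<bullet> ((1 / N A) *\<^sub>R A) \<le> dual_norm N B"
    unfolding dual_norm_eq using pos by (intro cSUP_upper dual_norm_bdd_above) (simp add: scaleR)
  then show ?thesis
    using pos by (simp add: field_simps)
qed simp

lemma abs_inner_le_dual_norm: "\<bar>B \<bullet> A\<bar> \<le> dual_norm N B * N A"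
  using inner_le_dual_norm[of B A] inner_le_dual_norm[of B "- A"]
  unfolding minus inner_minus_right by linarith

lemma dual_norm_nonneg: "0 \<le> dual_norm N B"
  unfolding dual_norm_eq
proof (rule cSUP_upper2[OF dual_norm_bdd_above])
  show "0 \<in> {A. N A \<le> 1}"
    by simp
qed simp

text \<open>Pairing \<open>B\<close> with itself gives a positive value.\<close>

lemma dual_norm_pos:
  assumes "B \<noteq> 0"
  shows "0 < dual_norm N B"
proof (rule ccontr)
  assume "\<not> 0 < dual_norm N B"
  then have "dual_norm N B * N B \<le> 0"
    using nonneg[of B] by (simp add: mult_nonpos_nonneg)
  then show False
    using inner_le_dual_norm[of B B] assms by (metis inner_gt_zero_iff not_le order_trans)
qed

lemma dual_norm_scaleR_le: "dual_norm N (c *\<^sub>R B) \<le> \<bar>c\<bar> * dual_norm N B"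
  unfolding dual_norm_eq[of "c *\<^sub>R B"]
proof (rule cSUP_least[OF unit_ball_nonempty])
  fix A assume "A \<in> {A. N A \<le> 1}"
  then have "\<bar>B \<bullet> A\<bar> \<le> dual_norm N B * 1"
    using abs_inner_le_dual_norm[of B A] dual_norm_nonneg[of B] mult_left_mono[of "N A" 1 "dual_norm N B"]
    by simp
  then have "\<bar>c\<bar> * \<bar>B \<bullet> A\<bar> \<le> \<bar>c\<bar> * dual_norm N B"
    by (intro mult_left_mono) auto
  then show "(c *\<^sub>R B) \<bullet> A \<le> \<bar>c\<bar> * dual_norm N B"
    using abs_ge_self[of "c * (B \<bullet> A)"] by (simp add: abs_mult)
qed

lemma dual_norm_triangle: "dual_norm N (B + B') \<le> dual_norm N B + dual_norm N B'"
  unfolding dual_norm_eq[of "B + B'"]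
proof (rule cSUP_least[OF unit_ball_nonempty])
  fix A assume A: "A \<in> {A. N A \<le> 1}"
  have "C \<bullet> A \<le> dual_norm N C" for C
    unfolding dual_norm_eq by (rule cSUP_upper[OF A dual_norm_bdd_above[of C]])
  from this[of B] this[of B'] show "(B + B') \<bullet> A \<le> dual_norm N B + dual_norm N B'"
    by (simp add: inner_add_left)
qed

end

locale matrix_norm_domain = matrix_norm N for N :: "real^'d^'d \<Rightarrow> real" +
  fixes X :: "(real^'d) set"
  assumes X_bounded: "bounded X" and X_nonempty: "X \<noteq> {}"
begin

text \<open>The function \<open>H\<close> of the overview. It is finite because \<open>X\<close> is
  bounded, and it is a seminorm because \<open>outer w x\<close> is linear in
  \<open>w\<close>.\<close>

definition sup_dual :: "real^'d \<Rightarrow> real" where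
  "sup_dual w = (SUP x\<in>X. dual_norm N (outer w x))"

lemma dual_outer_le_ex: "\<exists>c>0. \<forall>w. \<forall>x\<in>X. dual_norm N (outer w x) \<le> c * norm w"
proof -
  obtain c where c: "c > 0" "\<And>B. dual_norm N B \<le> c * norm B"
    using dual_norm_le_ex by blast
  obtain K where K: "K > 0" "\<And>x. x \<in> X \<Longrightarrow> norm x \<le> K"
    using X_bounded bounded_pos by blast
  have "dual_norm N (outer w x) \<le> (c * K) * norm w" if "x \<in> X" for w x
  proof -
    have "norm (outer w x) \<le> norm w * K"
      unfolding norm_outer using K(2)[OF that] by (intro mult_left_mono) auto
    then have "c * norm (outer w x) \<le> c * (norm w * K)"
      using c(1) by (intro mult_left_mono) auto
    then show ?thesis
      using c(2)[of "outer w x"] by (simp add: mult_ac)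
  qed
  then show ?thesis
    using c(1) K(1) by (intro exI[of _ "c * K"]) auto
qed

lemma sup_dual_bdd_above: "bdd_above ((\<lambda>x. dual_norm N (outer w x)) ` X)"
  using dual_outer_le_ex by (meson bdd_aboveI2)

lemma dual_outer_le_sup_dual: "x \<in> X \<Longrightarrow> dual_norm N (outer w x) \<le> sup_dual w"
  unfolding sup_dual_def by (intro cSUP_upper sup_dual_bdd_above)

lemma sup_dual_nonneg: "0 \<le> sup_dual w"
  using X_nonempty dual_outer_le_sup_dual dual_norm_nonneg order_trans by blast

lemma sup_dual_le_ex: "\<exists>c>0. \<forall>w. sup_dual w \<le> c * norm w"
proof -
  obtain c where "c > 0" "\<And>w x. x \<in> X \<Longrightarrow> dual_norm N (outer w x) \<le> c * norm w"
    using dual_outer_le_ex by blast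
  then show ?thesis
    unfolding sup_dual_def by (intro exI[of _ c] conjI allI cSUP_least X_nonempty) auto
qed

lemma sup_dual_scaleR_le: "sup_dual (c *\<^sub>R w) \<le> \<bar>c\<bar> * sup_dual w"
  unfolding sup_dual_def[of "c *\<^sub>R w"] outer_scaleR_left
  by (intro cSUP_least X_nonempty order_trans[OF dual_norm_scaleR_le] mult_left_mono dual_outer_le_sup_dual) auto

lemma sup_dual_triangle: "sup_dual (w + w') \<le> sup_dual w + sup_dual w'"
  unfolding sup_dual_def[of "w + w'"] outer_add_left
  by (intro cSUP_least X_nonempty order_trans[OF dual_norm_triangle] add_mono dual_outer_le_sup_dual)

text \<open>The supremum may run over an uncountable set, so measurability comes from continuity:
  subadditivity and a linear bound make the function Lipschitz.\<close>

lemma sup_dual_measurable [measurable]: "sup_dual \<in> borel_measurable borel"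
proof -
  obtain c where c: "c > 0" "\<And>w. sup_dual w \<le> c * norm w"
    using sup_dual_le_ex by blast
  have "sup_dual w - sup_dual w' \<le> c * norm (w - w')" for w w'
    using sup_dual_triangle[of "w - w'" w'] c(2)[of "w - w'"] by simp
  then have "\<bar>sup_dual w - sup_dual w'\<bar> \<le> c * norm (w - w')" for w w'
    by (metis abs_le_iff minus_diff_eq norm_minus_commute)
  then have "c-lipschitz_on UNIV sup_dual"
    using c(1) by (intro lipschitz_onI) (auto simp: dist_norm)
  then show ?thesis
    by (intro borel_measurable_continuous_onI lipschitz_on_continuous_on)
qed

lemma Xstar_bdd_above: "bdd_above ((\<lambda>p. dual_norm N (outer (snd p) (fst p))) ` (X \<times> X))"
proof -
  obtain c where c: "c > 0" "\<And>w x. x \<in> X \<Longrightarrow> dual_norm N (outer w x) \<le> c * norm w"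
    using dual_outer_le_ex by blast
  obtain K where K: "\<And>x. x \<in> X \<Longrightarrow> norm x \<le> K"
    using X_bounded bounded_pos by blast
  show ?thesis
  proof (rule bdd_aboveI2)
    fix p assume "p \<in> X \<times> X"
    then have "dual_norm N (outer (snd p) (fst p)) \<le> c * norm (snd p)" "norm (snd p) \<le> K"
      using c K by auto
    moreover have "c * norm (snd p) \<le> c * K"
      using calculation(2) c(1) by (intro mult_left_mono) auto
    ultimately show "dual_norm N (outer (snd p) (fst p)) \<le> c * K"
      by linarith
  qed
qed

lemma sup_dual_le_Xstar:
  assumes "x \<in> X"
  shows "sup_dual x \<le> Xstar N X"
  unfolding sup_dual_def
proof (rule cSUP_least[OF X_nonempty])
  fix y assume "y \<in> X"
  then show "dual_norm N (outer x y) \<le> Xstar N X"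
    unfolding Xstar_def using assms by (intro cSUP_upper2[OF Xstar_bdd_above, of "(y, x)"]) auto
qed

text \<open>A nonempty open set contains some \<open>x \<noteq> 0\<close>, and then
  \<open>outer x x\<close> is nonzero. Positivity is wanted because McDiarmid's inequality is
  applied with differences proportional to \<open>Xstar N X\<close>.\<close>

lemma Xstar_pos:
  assumes "open X"
  shows "Xstar N X > 0"
proof -
  obtain x where x: "x \<in> X" "x \<noteq> 0"
    using assms X_nonempty not_open_singleton[of "0 :: real^'d"] by (metis equals0I insertI1 singletonD subset_singletonD subsetI)
  then have "norm (outer x x) > 0"
    by (simp add: norm_outer)
  then have "0 < dual_norm N (outer x x)"
    by (intro dual_norm_pos) auto
  also have "\<dots> \<le> sup_dual x"
    by (rule dual_outer_le_sup_dual[OF x(1)])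
  also have "\<dots> \<le> Xstar N X"
    by (rule sup_dual_le_Xstar[OF x(1)])
  finally show ?thesis .
qed

end

section \<open>The generalization bound\<close>

lemma hyp_eq_inner: "hyp m z A a x = (\<Sum>j<m. a j *\<^sub>R (fst (z j) v* A)) \<bullet> x"
  by (simp add: hyp_def kerA_def inner_sum_left dot_lmul_matrix)

text \<open>At \<open>A = 0\<close> every hinge equals \<open>pos_part 1 = 1\<close>, so the
  objective is 1 there, while at the minimizer it is at least \<open>lam * N A\<close>.\<close>

lemma (in matrix_norm) emp_risk_A_minimizer_norm_le:
  assumes "is_arg_min (\<lambda>A. emp_risk_A m r z A + lam * N A) (\<lambda>A. transpose A = A) A"
    and "lam > 0" "m > 0"
  shows "N A \<le> 1 / lam"
proof -
  have "emp_risk_A m r z A + lam * N A \<le> emp_risk_A m r z 0 + lam * N 0"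
  proof -
    have "transpose (0 :: real^'d^'d) = 0"
      by (simp add: transpose_def vec_eq_iff)
    then show ?thesis
      using assms(1) unfolding is_arg_min_linorder by blast
  qed
  moreover have "emp_risk_A m r z 0 = 1"
    using \<open>m > 0\<close> by (simp add: emp_risk_A_def kerA_def pos_part_def)
  moreover have "0 \<le> emp_risk_A m r z A"
    unfolding emp_risk_A_def pos_part_def by (intro mult_nonneg_nonneg sum_nonneg) auto
  ultimately show ?thesis
    using \<open>lam > 0\<close> by (simp add: field_simps)
qed

context matrix_norm_domain
begin

text \<open>Membership in the polar set. Symmetry of \<open>A\<close> moves the sample point into
  the right slot of \<open>outer w (fst (z j))\<close>, over which \<open>sup_dual\<close> takes its
  supremum; this removes the dependence on the sample. The norm bound contributes
  \<open>1 / lam\<close>, the budget on the coefficients \<open>1 / r\<close>.\<close>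

lemma hyp_weight_inner_le:
  assumes A: "transpose A = A" "N A \<le> 1 / lam" and a: "(\<Sum>j<m. \<bar>a j\<bar>) \<le> 1 / r"
    and z: "\<And>j. j < m \<Longrightarrow> fst (z j) \<in> X" and pos: "lam > 0" "r > 0"
  shows "(\<Sum>j<m. a j *\<^sub>R (fst (z j) v* A)) \<bullet> w \<le> sup_dual w / (lam * r)"
proof -
  have "(\<Sum>j<m. a j *\<^sub>R (fst (z j) v* A)) \<bullet> w = (\<Sum>j<m. a j * (outer w (fst (z j)) \<bullet> A))"
    by (simp add: inner_sum_left dot_lmul_matrix inner_outer inner_matrix_symmetric[OF A(1), of w])
  also have "\<dots> \<le> (\<Sum>j<m. \<bar>a j\<bar> * (sup_dual w * (1 / lam)))"
  proof (rule sum_mono)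
    fix j assume "j \<in> {..<m}"
    then have "\<bar>outer w (fst (z j)) \<bullet> A\<bar> \<le> sup_dual w * (1 / lam)"
      by (intro order_trans[OF abs_inner_le_dual_norm] mult_mono dual_outer_le_sup_dual z A(2)
          sup_dual_nonneg nonneg) auto
    then have "\<bar>a j\<bar> * \<bar>outer w (fst (z j)) \<bullet> A\<bar> \<le> \<bar>a j\<bar> * (sup_dual w * (1 / lam))"
      by (intro mult_left_mono) auto
    then show "a j * (outer w (fst (z j)) \<bullet> A) \<le> \<bar>a j\<bar> * (sup_dual w * (1 / lam))"
      using abs_ge_self[of "a j * (outer w (fst (z j)) \<bullet> A)"] by (simp add: abs_mult)
  qed
  also have "\<dots> = (\<Sum>j<m. \<bar>a j\<bar>) * (sup_dual w * (1 / lam))"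
    by (simp only: sum_distrib_right)
  also have "\<dots> \<le> 1 / r * (sup_dual w * (1 / lam))"
    using pos by (intro mult_right_mono a mult_nonneg_nonneg sup_dual_nonneg) auto
  finally show ?thesis by (simp add: mult.commute)
qed

text \<open>\<open>outer\<close> is linear in its left argument, so the signed average of matrices
  is \<open>outer\<close> of one signed mean vector.\<close>

lemma rademacher_eq:
  "rademacher N X rho m =
     (\<integral>z. (\<Sum>\<sigma>\<in>{..<m} \<rightarrow>\<^sub>E {-1, 1}. sup_dual ((1 / real m) *\<^sub>R (\<Sum>i<m. \<sigma> i *\<^sub>R (snd (z i) *\<^sub>R fst (z i))))) / 2 ^ m
        \<partial>PiM {..<m} (\<lambda>_. rho))"
  unfolding rademacher_def sup_dual_def
  by (simp only: outer_scaleR_left outer_sum_left scaleR_scaleR)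

end


theorem theorem4:
  fixes X :: "(real^'d) set" and rho :: "((real^'d) \<times> real) measure"
    and N :: "real^'d^'d \<Rightarrow> real" and m :: nat and r lam \<delta> :: real
    and Az :: "(nat \<Rightarrow> (real^'d) \<times> real) \<Rightarrow> real^'d^'d"
    and alpha :: "(nat \<Rightarrow> (real^'d) \<times> real) \<Rightarrow> nat \<Rightarrow> real"
  assumes "bounded X" and "open X" and "connected X" and "X \<noteq> {}"
    and "prob_space rho" and "sets rho = sets borel"
    and "AE p in rho. fst p \<in> X \<and> snd p \<in> {-1, 1}"
    and "m > 0" and "r > 0" and "lam > 0" and "is_matrix_norm N"
    and "\<And>z. z \<in> space (PiM {..<m} (\<lambda>_. rho)) \<Longrightarrow>
           is_arg_min (\<lambda>A. emp_risk_A m r z A + lam * N A) (\<lambda>A. transpose A = A) (Az z)"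
    and "\<And>z. z \<in> space (PiM {..<m} (\<lambda>_. rho)) \<Longrightarrow>
           is_arg_min (\<lambda>a. emp_risk_f m z (hyp m z (Az z) a))
                      (\<lambda>a. (\<Sum>j<m. \<bar>a j\<bar>) \<le> 1 / r) (alpha z)"
    and "0 < \<delta>" and "\<delta> < 1"
  shows "\<exists>E\<in>sets (PiM {..<m} (\<lambda>_. rho)).
           measure (PiM {..<m} (\<lambda>_. rho)) E \<ge> 1 - \<delta> \<and>
           (\<forall>z\<in>E. risk rho (hyp m z (Az z) (alpha z)) - emp_risk_f m z (hyp m z (Az z) (alpha z))
                   \<le> 4 * rademacher N X rho m / (lam * r)
                     + 2 * Xstar N X / (lam * r) * sqrt (2 * ln (1 / \<delta>) / real m))"
proof -
  interpret matrix_norm_domain N X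
    by unfold_locales (use assms in auto)
  interpret prob_space rho by fact
  let ?P = "PiM {..<m} (\<lambda>_. rho)"
  interpret P: prob_space ?P by (rule prob_space_PiM_iid)
  note pos = \<open>m > 0\<close> \<open>r > 0\<close> \<open>lam > 0\<close> \<open>0 < \<delta>\<close> \<open>\<delta> < 1\<close>
  obtain x0 where x0: "x0 \<in> X" using X_nonempty by blast
  obtain K where K: "K > 0" "\<And>x. x \<in> X \<Longrightarrow> norm x \<le> K"
    using X_bounded bounded_pos by blast
  obtain c where c: "c > 0" "\<And>w. sup_dual w \<le> c * norm w"
    using sup_dual_le_ex by blast

  \<comment> \<open>Signed sample points, bounded everywhere\<close>
  define good where "good = X \<times> {-1, 1::real}"
  have good_borel: "good \<in> sets borel"
    unfolding good_def borel_prod[symmetric] using \<open>open X\<close> by (intro pair_measureI) auto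
  have AE_good: "AE p in rho. p \<in> good"
    using assms(7) by (rule AE_mp) (auto simp: good_def)
  \<comment> \<open>The sample lies in \<open>good\<close> only almost surely; \<open>g\<close> makes \<open>y x\<close> bounded everywhere.\<close>
  define g where "g p = (if p \<in> good then snd p *\<^sub>R fst p else x0)" for p
  have "(\<lambda>p. snd p *\<^sub>R fst p) \<in> borel_measurable (borel :: ((real^'d) \<times> real) measure)"
    by (intro borel_measurable_continuous_onI continuous_intros)
  then have g_measurable [measurable]: "g \<in> borel_measurable rho"
    unfolding g_def measurable_cong_sets[OF \<open>sets rho = sets borel\<close> refl]
    using good_borel by (intro measurable_If_set) auto
  \<comment> \<open>The default \<open>x0\<close> has this form too, with sign 1, so bounds obtained
    from points of \<open>X\<close> hold for every \<open>p\<close>.\<close>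
  have g_cases: "\<exists>s x. \<bar>s\<bar> = 1 \<and> x \<in> X \<and> g p = s *\<^sub>R x" for p
  proof (cases "p \<in> good")
    case True
    then show ?thesis
      by (intro exI[of _ "snd p"] exI[of _ "fst p"]) (auto simp: g_def good_def)
  next
    case False
    then show ?thesis
      using x0 by (intro exI[of _ 1] exI[of _ x0]) (simp add: g_def)
  qed
  have norm_g: "norm (g p) \<le> K" for p
  proof -
    obtain s x where "\<bar>s\<bar> = 1" "x \<in> X" "g p = s *\<^sub>R x"
      using g_cases by blast
    then show ?thesis using K(2)[of x] by simp
  qed
  have sup_dual_minus: "sup_dual (s *\<^sub>R x) \<le> sup_dual x" if "\<bar>s\<bar> = 1" for s x
    using sup_dual_scaleR_le[of s x] that by simp

  \<comment> \<open>The sample-free class and a dense sequence in it\<close>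
  define V where "V = {v. \<forall>w. v \<bullet> w \<le> sup_dual w / (lam * r)}"
  define B where "B = Xstar N X / (lam * r)"
  have B_pos: "B > 0"
    unfolding B_def using Xstar_pos[OF \<open>open X\<close>] pos by simp
  have V_bound: "\<bar>v \<bullet> g p\<bar> \<le> B" if v: "v \<in> V" for v p
  proof -
    obtain s x where sx: "\<bar>s\<bar> = 1" "x \<in> X" "g p = s *\<^sub>R x"
      using g_cases by blast
    \<comment> \<open>Used for \<open>t = s\<close> and \<open>t = - s\<close>: the polar inequality
      at \<open>g p\<close> and at its negative gives the absolute value.\<close>
    have "v \<bullet> (t *\<^sub>R x) \<le> B" if "\<bar>t\<bar> = 1" for t
    proof -
      have "v \<bullet> (t *\<^sub>R x) \<le> sup_dual (t *\<^sub>R x) / (lam * r)"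
        using v unfolding V_def by blast
      also have "\<dots> \<le> B"
        unfolding B_def using pos sup_dual_minus[OF that, of x] sup_dual_le_Xstar[OF sx(2)]
        by (intro divide_right_mono) auto
      finally show ?thesis .
    qed
    from this[of s] this[of "- s"] sx show ?thesis
      by (simp add: abs_le_iff)
  qed
  obtain V0 where V0: "countable V0" "V0 \<subseteq> V" "V \<subseteq> closure V0"
    by (rule separable)
  \<comment> \<open>Serves to make \<open>V0\<close> nonempty, as \<open>from_nat_into\<close> needs
    in order to enumerate it.\<close>
  have "0 \<in> V"
    using pos by (simp add: V_def sup_dual_nonneg)
  then have "V0 \<noteq> {}"
    using V0(3) by auto
  define v where "v = from_nat_into V0"
  have v_V: "v k \<in> V" for k
    using from_nat_into[OF \<open>V0 \<noteq> {}\<close>] V0(2) by (auto simp: v_def)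

  interpret L: lipschitz_loss_class rho "\<lambda>k p. v k \<bullet> g p" "\<lambda>u. pos_part (1 - u)"
  proof unfold_locales
    show "bounded_class rho (\<lambda>k p. v k \<bullet> g p)"
      by (rule bounded_classI) (rule V_bound[OF v_V])
  qed (auto simp: pos_part_def)

  \<comment> \<open>The event for the dense sequence\<close>
  define D where "D u z = (\<integral>p. pos_part (1 - u \<bullet> g p) \<partial>rho) - (1 / real m) * (\<Sum>i<m. pos_part (1 - u \<bullet> g (z i)))"
    for u and z :: "nat \<Rightarrow> (real^'d) \<times> real"
  define T where "T = (\<integral>z. (\<Sum>\<sigma>\<in>{..<m} \<rightarrow>\<^sub>E {-1, 1}. SUP k. 2 * (\<Sum>i<m. \<sigma> i * (v k \<bullet> g (z i)))) / 2 ^ m \<partial>?P)"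
  obtain E where E: "E \<in> sets ?P" "measure ?P E \<ge> 1 - \<delta>"
    and E_dev: "\<And>z k. z \<in> E \<Longrightarrow> D (v k) z \<le> T / real m + B * sqrt (2 * ln (1 / \<delta>) / real m)"
    using L.uniform_deviation[OF V_bound[OF v_V] B_pos pos(1,4,5)]
    unfolding L.mean_loss_def L.loss_def D_def T_def by blast

  \<comment> \<open>Comparison with the Rademacher average\<close>
  define Q where "Q z = (\<Sum>\<sigma>\<in>{..<m} \<rightarrow>\<^sub>E {-1, 1}. sup_dual ((1 / real m) *\<^sub>R (\<Sum>i<m. \<sigma> i *\<^sub>R g (z i)))) / 2 ^ m"
    for z
  have g_comp [measurable]: "(\<lambda>z. g (z i)) \<in> borel_measurable ?P" if "i < m" for i
    using that by (intro measurable_PiM_component_compose g_measurable) simp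
  have Q_measurable [measurable]: "Q \<in> borel_measurable ?P"
    unfolding Q_def
    by (intro borel_measurable_divide borel_measurable_sum measurable_compose[OF _ sup_dual_measurable]
        borel_measurable_scaleR borel_measurable_const g_comp) simp_all
  have Q_nonneg: "0 \<le> Q z" for z
    unfolding Q_def by (intro divide_nonneg_nonneg sum_nonneg sup_dual_nonneg) simp
  have Q_le: "Q z \<le> c * K" for z
  proof -
    have "sup_dual ((1 / real m) *\<^sub>R (\<Sum>i<m. \<sigma> i *\<^sub>R g (z i))) \<le> c * K"
      if \<sigma>: "\<sigma> \<in> {..<m} \<rightarrow>\<^sub>E {-1, 1}" for \<sigma> :: "nat \<Rightarrow> real"
    proof -
      have "norm (\<Sum>i<m. \<sigma> i *\<^sub>R g (z i)) \<le> (\<Sum>i<m. K)"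
      proof (rule sum_norm_le)
        fix i assume "i \<in> {..<m}"
        then have "\<bar>\<sigma> i\<bar> = 1"
          using PiE_mem[OF \<sigma>] by fastforce
        then show "norm (\<sigma> i *\<^sub>R g (z i)) \<le> K"
          using norm_g by simp
      qed
      then have "norm ((1 / real m) *\<^sub>R (\<Sum>i<m. \<sigma> i *\<^sub>R g (z i))) \<le> K"
        using pos by (simp add: field_simps)
      then show ?thesis
        using c by (meson less_imp_le mult_left_mono order_trans)
    qed
    then have "(\<Sum>\<sigma>\<in>{..<m} \<rightarrow>\<^sub>E {-1, 1}. sup_dual ((1 / real m) *\<^sub>R (\<Sum>i<m. \<sigma> i *\<^sub>R g (z i))))
        \<le> (\<Sum>\<sigma>\<in>{..<m} \<rightarrow>\<^sub>E {-1, 1::real}. c * K)"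
      by (rule sum_mono)
    then show ?thesis
      by (simp add: Q_def card_funcsetE field_simps)
  qed
  have Q_integrable: "integrable ?P Q"
    by (rule P.integrable_const_bound[where B="c * K"]) (auto simp: Q_nonneg Q_le)
  have AE_good_all: "AE z in ?P. \<forall>i<m. z i \<in> good"
  proof -
    have "AE z in ?P. \<forall>i\<in>{..<m}. z i \<in> good"
      using AE_PiM_component[of "{..<m}" "\<lambda>_. rho", OF prob_space_axioms _ AE_good]
      by (intro AE_finite_allI) auto
    then show ?thesis by (rule AE_mp) auto
  qed
  have yx_comp: "(\<lambda>z. snd (z i) *\<^sub>R fst (z i)) \<in> borel_measurable ?P" if "i < m" for i
  proof (rule measurable_PiM_component_compose[where u="\<lambda>p. snd p *\<^sub>R fst p"])
    show "(\<lambda>p. snd p *\<^sub>R fst p) \<in> borel_measurable rho"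
      unfolding measurable_cong_sets[OF \<open>sets rho = sets borel\<close> refl]
      by (intro borel_measurable_continuous_onI continuous_intros)
  qed (use that in simp)
  \<comment> \<open>Almost every sample has all its points in \<open>good\<close>, where
    \<open>g (z i)\<close> is the signed point itself.\<close>
  have rad: "rademacher N X rho m = (\<integral>z. Q z \<partial>?P)"
    unfolding rademacher_eq
  proof (rule integral_cong_AE)
    show "(\<lambda>z. (\<Sum>\<sigma>\<in>{..<m} \<rightarrow>\<^sub>E {-1, 1}. sup_dual ((1 / real m) *\<^sub>R
        (\<Sum>i<m. \<sigma> i *\<^sub>R (snd (z i) *\<^sub>R fst (z i))))) / 2 ^ m) \<in> borel_measurable ?P"
      by (intro borel_measurable_divide borel_measurable_sum measurable_compose[OF _ sup_dual_measurable]
        borel_measurable_scaleR borel_measurable_const yx_comp) simp_all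
    show "AE z in ?P. (\<Sum>\<sigma>\<in>{..<m} \<rightarrow>\<^sub>E {-1, 1}. sup_dual ((1 / real m) *\<^sub>R
        (\<Sum>i<m. \<sigma> i *\<^sub>R (snd (z i) *\<^sub>R fst (z i))))) / 2 ^ m = Q z"
      using AE_good_all by eventually_elim (simp add: Q_def g_def)
  qed (rule Q_measurable)
  have "T \<le> (\<integral>z. 2 * real m / (lam * r) * Q z \<partial>?P)"
    unfolding T_def
  proof (rule integral_mono')
    fix z
    have "(SUP k. 2 * (\<Sum>i<m. \<sigma> i * (v k \<bullet> g (z i))))
        \<le> 2 * real m / (lam * r) * sup_dual ((1 / real m) *\<^sub>R (\<Sum>i<m. \<sigma> i *\<^sub>R g (z i)))" for \<sigma> :: "nat \<Rightarrow> real"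
    proof (rule cSUP_least)
      fix k
      let ?w = "(1 / real m) *\<^sub>R (\<Sum>i<m. \<sigma> i *\<^sub>R g (z i))"
      \<comment> \<open>The sum is \<open>m\<close> times the pairing with the signed mean
        \<open>?w\<close>, where the polar inequality applies; the factor \<open>m\<close> cancels
        in \<open>T / real m\<close>.\<close>
      have "2 * (\<Sum>i<m. \<sigma> i * (v k \<bullet> g (z i))) = 2 * real m * (v k \<bullet> ?w)"
        using pos by (simp add: inner_sum_right)
      also have "\<dots> \<le> 2 * real m * (sup_dual ?w / (lam * r))"
      proof (rule mult_left_mono)
        show "v k \<bullet> ?w \<le> sup_dual ?w / (lam * r)"
          using v_V[of k] unfolding V_def by blast
      qed simp
      finally show "2 * (\<Sum>i<m. \<sigma> i * (v k \<bullet> g (z i))) \<le> 2 * real m / (lam * r) * sup_dual ?w"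
        by simp
    qed simp
    then have "(\<Sum>\<sigma>\<in>{..<m} \<rightarrow>\<^sub>E {-1, 1}. SUP k. 2 * (\<Sum>i<m. \<sigma> i * (v k \<bullet> g (z i))))
        \<le> 2 * real m / (lam * r) * (\<Sum>\<sigma>\<in>{..<m} \<rightarrow>\<^sub>E {-1, 1}. sup_dual ((1 / real m) *\<^sub>R (\<Sum>i<m. \<sigma> i *\<^sub>R g (z i))))"
      unfolding sum_distrib_left by (rule sum_mono)
    then have "(\<Sum>\<sigma>\<in>{..<m} \<rightarrow>\<^sub>E {-1, 1}. SUP k. 2 * (\<Sum>i<m. \<sigma> i * (v k \<bullet> g (z i)))) / 2 ^ m
        \<le> 2 * real m / (lam * r) * (\<Sum>\<sigma>\<in>{..<m} \<rightarrow>\<^sub>E {-1, 1}. sup_dual ((1 / real m) *\<^sub>R (\<Sum>i<m. \<sigma> i *\<^sub>R g (z i)))) / 2 ^ m"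
      by (rule divide_right_mono) simp
    then show "(\<Sum>\<sigma>\<in>{..<m} \<rightarrow>\<^sub>E {-1, 1}. SUP k. 2 * (\<Sum>i<m. \<sigma> i * (v k \<bullet> g (z i)))) / 2 ^ m
        \<le> 2 * real m / (lam * r) * Q z"
      by (simp only: Q_def times_divide_eq_right)
    show "0 \<le> 2 * real m / (lam * r) * Q z"
      using pos by (intro mult_nonneg_nonneg Q_nonneg) simp
  qed (intro integrable_mult_right Q_integrable)
  then have T: "T / real m \<le> 2 * rademacher N X rho m / (lam * r)"
    using pos by (simp add: rad field_simps)
  have rad_nonneg: "0 \<le> rademacher N X rho m"
    unfolding rad by (rule Bochner_Integration.integral_nonneg) (rule Q_nonneg)

  define bound where "bound = 4 * rademacher N X rho m / (lam * r)
     + 2 * Xstar N X / (lam * r) * sqrt (2 * ln (1 / \<delta>) / real m)"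
  have bound: "T / real m + B * sqrt (2 * ln (1 / \<delta>) / real m) \<le> bound"
  proof -
    \<comment> \<open>Both terms are nonnegative and are doubled to reach the stated
      constants.\<close>
    have "2 * rademacher N X rho m / (lam * r) \<le> 4 * rademacher N X rho m / (lam * r)"
      using pos rad_nonneg by (intro divide_right_mono) auto
    moreover have "B * sqrt (2 * ln (1 / \<delta>) / real m) \<le> 2 * B * sqrt (2 * ln (1 / \<delta>) / real m)"
      using B_pos pos by (intro mult_right_mono) auto
    ultimately show ?thesis
      using T by (simp add: bound_def B_def)
  qed

  \<comment> \<open>Passage from the dense sequence to the whole class\<close>
  have D_continuous: "continuous_on UNIV (\<lambda>u. D u z)" for z
  proof -
    \<comment> \<open>\<open>g\<close> is bounded by \<open>K\<close> everywhere, so the Lipschitz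
      constant in \<open>u\<close> is uniform in \<open>p\<close> and survives integration.\<close>
    have lip: "\<bar>pos_part (1 - u \<bullet> g p) - pos_part (1 - u' \<bullet> g p)\<bar> \<le> K * norm (u - u')" for u u' p
    proof -
      have "\<bar>pos_part (1 - u \<bullet> g p) - pos_part (1 - u' \<bullet> g p)\<bar> \<le> \<bar>(u - u') \<bullet> g p\<bar>"
        by (auto simp: pos_part_def inner_diff_left)
      also have "\<dots> \<le> norm (u - u') * norm (g p)"
        by (rule Cauchy_Schwarz_ineq2)
      also have "\<dots> \<le> norm (u - u') * K"
        by (intro mult_left_mono norm_g) simp
      finally show ?thesis by (simp add: mult.commute)
    qed
    have int: "integrable rho (\<lambda>p. pos_part (1 - u \<bullet> g p))" for u
    proof (rule integrable_const_bound[where B="1 + K * norm u"])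
      have "norm (pos_part (1 - u \<bullet> g p)) \<le> 1 + K * norm u" for p
        using lip[of u p 0] by (simp add: pos_part_def)
      then show "AE p in rho. norm (pos_part (1 - u \<bullet> g p)) \<le> 1 + K * norm u"
        by simp
    qed (unfold pos_part_def, measurable)
    have "K-lipschitz_on UNIV (\<lambda>u. \<integral>p. pos_part (1 - u \<bullet> g p) \<partial>rho)"
    proof (rule lipschitz_onI)
      fix u u'
      have "\<bar>(\<integral>p. pos_part (1 - u \<bullet> g p) \<partial>rho) - (\<integral>p. pos_part (1 - u' \<bullet> g p) \<partial>rho)\<bar>
          = \<bar>\<integral>p. pos_part (1 - u \<bullet> g p) - pos_part (1 - u' \<bullet> g p) \<partial>rho\<bar>"
        by (simp add: int)
      also have "\<dots> \<le> (\<integral>p. \<bar>pos_part (1 - u \<bullet> g p) - pos_part (1 - u' \<bullet> g p)\<bar> \<partial>rho)"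
        by (rule integral_abs_bound)
      also have "\<dots> \<le> (\<integral>p. K * norm (u - u') \<partial>rho)"
        by (intro integral_mono integrable_abs Bochner_Integration.integrable_diff int lip) simp
      finally show "dist (\<integral>p. pos_part (1 - u \<bullet> g p) \<partial>rho) (\<integral>p. pos_part (1 - u' \<bullet> g p) \<partial>rho) \<le> K * dist u u'"
        by (simp add: prob_space dist_norm)
    qed (use K in simp)
    \<comment> \<open>\<open>pos_part\<close> is unfolded in the finite sum only; under the integral
      it stays folded so that the Lipschitz fact still matches.\<close>
    then show ?thesis
      unfolding D_def pos_part_def[of "1 - _ \<bullet> g (z _)"]
      by (intro continuous_intros lipschitz_on_continuous_on)
  qed
  have D_bound: "D u z \<le> bound" if z: "z \<in> E" and u: "u \<in> V" for u z
  proof -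
    have "V0 \<subseteq> {u. D u z \<le> bound}"
    proof
      fix u assume "u \<in> V0"
      then obtain k where "u = v k"
        using from_nat_into_surj[OF V0(1)] v_def by metis
      then show "u \<in> {u. D u z \<le> bound}"
        using E_dev[OF z, of k] bound by simp
    qed
    moreover have "closed {u. D u z \<le> bound}"
      by (intro closed_Collect_le D_continuous continuous_intros)
    ultimately have "closure V0 \<subseteq> {u. D u z \<le> bound}"
      by (rule closure_minimal)
    then show ?thesis
      using u V0(3) by blast
  qed

  \<comment> \<open>From the class to the selected hypotheses\<close>
  define G where "G = E \<inter> (\<Pi>\<^sub>E i\<in>{..<m}. good)"
  \<comment> \<open>The conclusion is claimed for every sample of the event, so almost sure
    membership in \<open>good\<close> does not suffice; the intersection loses no
    probability.\<close>
  have PiE_good: "(\<Pi>\<^sub>E i\<in>{..<m}. good) \<in> sets ?P"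
    using good_borel \<open>sets rho = sets borel\<close> by (intro sets_PiM_I_finite) auto
  have G_sets: "G \<in> sets ?P"
    unfolding G_def using E(1) PiE_good by blast
  have "measure ?P G = measure ?P E"
  proof (rule P.finite_measure_eq_AE[OF _ G_sets E(1)])
    show "AE z in ?P. z \<in> G \<longleftrightarrow> z \<in> E"
      using AE_good_all AE_space
      by eventually_elim (auto simp: G_def space_PiM PiE_iff)
  qed
  moreover have "risk rho (hyp m z (Az z) (alpha z)) - emp_risk_f m z (hyp m z (Az z) (alpha z)) \<le> bound"
    if z: "z \<in> G" for z
  proof -
    define u where "u = (\<Sum>j<m. alpha z j *\<^sub>R (fst (z j) v* Az z))"
    have z_space: "z \<in> space ?P" and z_E: "z \<in> E"
      using z E(1) sets.sets_into_space by (auto simp: G_def)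
    have z_good: "z i \<in> good" if "i < m" for i
      using z that by (auto simp: G_def)
    have hyp: "hyp m z (Az z) (alpha z) = (\<lambda>x. u \<bullet> x)"
      by (simp add: u_def hyp_eq_inner fun_eq_iff)
    \<comment> \<open>Locates the selected hypothesis in the class fixed beforehand, so that
      \<open>D_bound\<close> applies although \<open>u\<close> depends on \<open>z\<close>.\<close>
    have "u \<in> V"
      unfolding V_def u_def
    proof (intro CollectI allI hyp_weight_inner_le)
      show "transpose (Az z) = Az z" "(\<Sum>j<m. \<bar>alpha z j\<bar>) \<le> 1 / r"
        using assms(12,13)[OF z_space] by (simp_all add: is_arg_min_def)
      show "N (Az z) \<le> 1 / lam"
        by (rule emp_risk_A_minimizer_norm_le[OF assms(12)[OF z_space] pos(3,1)])
      show "fst (z j) \<in> X" if "j < m" for j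
        using z_good[OF that] by (auto simp: good_def)
    qed (use pos in simp_all)
    have "risk rho (\<lambda>x. u \<bullet> x) = (\<integral>p. pos_part (1 - u \<bullet> g p) \<partial>rho)"
      unfolding risk_def
    proof (rule integral_cong_AE)
      have "(\<lambda>p. pos_part (1 - snd p * (u \<bullet> fst p))) \<in> borel_measurable (borel :: ((real^'d) \<times> real) measure)"
        unfolding pos_part_def by (intro borel_measurable_continuous_onI continuous_intros)
      then show "(\<lambda>p. pos_part (1 - snd p * (u \<bullet> fst p))) \<in> borel_measurable rho"
        unfolding measurable_cong_sets[OF \<open>sets rho = sets borel\<close> refl] .
      show "(\<lambda>p. pos_part (1 - u \<bullet> g p)) \<in> borel_measurable rho"
        unfolding pos_part_def by measurable
      show "AE p in rho. pos_part (1 - snd p * (u \<bullet> fst p)) = pos_part (1 - u \<bullet> g p)"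
        using AE_good by eventually_elim (simp add: g_def)
    qed
    moreover have "emp_risk_f m z (\<lambda>x. u \<bullet> x) = (1 / real m) * (\<Sum>i<m. pos_part (1 - u \<bullet> g (z i)))"
      unfolding emp_risk_f_def using z_good by (simp add: g_def)
    ultimately show ?thesis
      using D_bound[OF z_E \<open>u \<in> V\<close>] by (simp add: hyp D_def)
  qed
  ultimately show ?thesis
    using E(2) G_sets unfolding bound_def[symmetric] by (intro bexI[of _ G]) auto
qed

end
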